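(* Let $\mathscr{A}$ be a toric arrangement, and suppose $\mathscr{P}(\mathscr{A}_Y)$ is a corank-one M-ideal of $\mathscr{P}(\mathscr{A})$, with associated map $\bar p\colon M(\mathscr{A})\to M(\mathscr{A}/Y)$. (1) There are a composition $\mathbf{n}$ and a continuous map $f\colon M(\mathscr{A}/Y)\to\mathrm{Conf}^{\mathbf{n}}(\mathbb{C})$ such that $\bar p\colon M(\mathscr{A})\to M(\mathscr{A}/Y)$ is the pullback of the bundle $\pi\colon\mathrm{Conf}^{(\mathbf{n},1)}(\mathbb{C})\to\mathrm{Conf}^{\mathbf{n}}(\mathbb{C})$ along $f$. Moreover, there is a positive integer $n$ such that: (2) there is a continuous map $\mathbf{a}\colon M(\mathscr{A}/Y)\to\mathrm{Conf}_n(\mathbb{C})/\Sigma_n$ such that $\bar p$ is the pullback of the bundle $\pi\colon\mathrm{Conf}^{(n,1)}(\mathbb{C})\to\mathrm{Conf}^{(n)}(\mathbb{C})=\mathrm{Conf}_n(\mathbb{C})/\Sigma_n$ over the unordered configuration space along $\mathbf{a}$; (3) if $\mathscr{P}(\mathscr{A}_Y)$ is a TM-ideal, there is a continuous map $\mathbf{b}\colon M(\mathscr{A}/Y)\to\mathrm{Conf}_n(\mathbb{C})$ such that $\bar p$ is the pullback of the bundle $\pi\colon\mathrm{Conf}_{n+1}(\mathbb{C})\to\mathrm{Conf}_n(\mathbb{C})$ over the ordered configuration space along $\mathbf{b}$.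
   Context: Let $\Gamma\cong\mathbb{Z}^d$ be a finitely generated free abelian group and $T=\mathrm{Hom}(\Gamma,\mathbb{C}^\times)\cong(\mathbb{C}^\times)^d$. For $\chi\in\Gamma$ put $H_\chi=\{t\in T\mid t(\chi)=1\}$. A toric arrangement $\mathscr{A}$ in $T$ is the set of all connected components of the subspaces $H_\chi$, $\chi\in\mathfrak{X}$, for a finite set $\mathfrak{X}\subseteq\Gamma\smallsetminus\{0\}$. Its complement is $M(\mathscr{A})=T\smallsetminus\bigcup_{\chi\in\mathfrak{X}}H_\chi$. Its poset of layers $\mathscr{P}(\mathscr{A})$ is the set of nonempty connected components of the intersections $\bigcap_{\chi\in S}H_\chi$, $S\subseteq\mathfrak{X}$, ordered by reverse inclusion. A subgroup $Y\subseteq T$ is admissible if there is a direct sum decomposition $\Gamma=\Gamma'\oplus\Gamma''$ with $\Gamma'$ of rank one such that $Y=\{t\in T\mid t|_{\Gamma''}\equiv1\}$. Then $T/Y\cong\mathrm{Hom}(\Gamma'',\mathbb{C}^\times)$, and $p\colon T\to T/Y$ denotes the projection. Put $\mathscr{A}_Y=\{H\in\mathscr{A}\mid H \text{ is a union of cosets of } Y\}$ and $\mathscr{A}/Y=\{p(H)\mid H\in\mathscr{A}_Y\}$, a toric arrangement in $T/Y$. The map $p$ restricts to $\bar p\colon M(\mathscr{A})\to M(\mathscr{A}/Y)$. $\mathscr{P}(\mathscr{A}_Y)$ is an M-ideal of $\mathscr{P}(\mathscr{A})$ if for any two distinct $H_1,H_2\in\mathscr{A}\smallsetminus\mathscr{A}_Y$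 and any connected component $X$ of $H_1\cap H_2$ there is $H_3\in\mathscr{A}_Y$ with $H_3\supseteq X$; it is a TM-ideal if in addition $H\cap Y$ is connected for all $H\in\mathscr{A}\smallsetminus\mathscr{A}_Y$. "Corank-one" means that $Y$ is admissible and the rank of $\mathscr{P}(\mathscr{A}_Y)$ is one less than that of $\mathscr{P}(\mathscr{A})$. $\mathrm{Conf}_k(X)\subseteq X^k$ is the ordered configuration space of $k$-tuples of pairwise distinct points. For a composition $\mathbf{k}=(k_1,\dots,k_m)$ of $k$ (positive integers with sum $k$), $\mathrm{Conf}^{\mathbf{k}}(X)=\mathrm{Conf}_k(X)/(\Sigma_{k_1}\times\dots\times\Sigma_{k_m})$; its elements are tuples $(S_1,\dots,S_m)$ of pairwise disjoint subsets of $X$ with $|S_i|=k_i$. With $(\mathbf{k},1)=(k_1,\dots,k_m,1)$, the bundle $\pi\colon\mathrm{Conf}^{(\mathbf{k},1)}(X)\to\mathrm{Conf}^{\mathbf{k}}(X)$ forgets the last entry; likewise $\mathrm{Conf}_{n+1}(X)\to\mathrm{Conf}_n(X)$ forgets the last coordinate. *)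

theory Defs
  imports
    "HOL-Analysis.Analysis"
    "HOL-Algebra.Free_Abelian_Groups"
    "HOL-Combinatorics.Permutations"
begin

section \<open>Quotient topologies and pullbacks\<close>

definition quotient_topology :: "'a topology \<Rightarrow> ('a \<Rightarrow> 'b) \<Rightarrow> 'b topology" where
  "quotient_topology X q =
     topology (\<lambda>U. U \<subseteq> q ` topspace X \<and> openin X {x \<in> topspace X. q x \<in> U})"

lemma openin_quotient_topology:
  "openin (quotient_topology X q) U \<longleftrightarrow>
     U \<subseteq> q ` topspace X \<and> openin X {x \<in> topspace X. q x \<in> U}"
proof -
  let ?L = "\<lambda>U. U \<subseteq> q ` topspace X \<and> openin X {x \<in> topspace X. q x \<in> U}"
  have "istopology ?L"
    unfolding istopology_def
  proof (intro conjI allI impI)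
    fix S T assume S: "?L S" and T: "?L T"
    show "S \<inter> T \<subseteq> q ` topspace X" using S by blast
    have "{x \<in> topspace X. q x \<in> S \<inter> T} = {x \<in> topspace X. q x \<in> S} \<inter> {x \<in> topspace X. q x \<in> T}"
      by blast
    then show "openin X {x \<in> topspace X. q x \<in> S \<inter> T}"
      using S T by (simp add: openin_Int)
  next
    fix K assume K: "\<forall>S\<in>K. ?L S"
    show "\<Union>K \<subseteq> q ` topspace X" using K by blast
    have "{x \<in> topspace X. q x \<in> \<Union>K} = (\<Union>S\<in>K. {x \<in> topspace X. q x \<in> S})"
      by blast
    then show "openin X {x \<in> topspace X. q x \<in> \<Union>K}"
      using K by auto
  qed
  then show ?thesis
    by (simp add: quotient_topology_def topology_inverse')
qed

lemma topspace_quotient_topology [simp]: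
  "topspace (quotient_topology X q) = q ` topspace X"
proof (rule antisym)
  show "topspace (quotient_topology X q) \<subseteq> q ` topspace X"
    by (auto simp: topspace_def openin_quotient_topology)
  have "{x \<in> topspace X. q x \<in> q ` topspace X} = topspace X" by blast
  then show "q ` topspace X \<subseteq> topspace (quotient_topology X q)"
    by (intro openin_subset) (simp add: openin_quotient_topology)
qed

lemma quotient_map_quotient_topology: "quotient_map X (quotient_topology X q) q"
  by (auto simp: quotient_map_def openin_quotient_topology)

text \<open>
  \<open>q : E' \<rightarrow> B'\<close> is the pullback of \<open>\<pi> : E \<rightarrow> B\<close> along \<open>f : B' \<rightarrow> B\<close>: there is a map \<open>F : E' \<rightarrow> E\<close>
  over \<open>f\<close> such that \<open>(q, F)\<close> is a homeomorphism onto the fibre product, compatible with the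
  projections to \<open>B'\<close>.
\<close>

definition is_pullback_along ::
  "'a topology \<Rightarrow> 'b topology \<Rightarrow> ('a \<Rightarrow> 'b) \<Rightarrow> 'c topology \<Rightarrow> 'd topology \<Rightarrow> ('c \<Rightarrow> 'd) \<Rightarrow> ('b \<Rightarrow> 'd) \<Rightarrow> bool"
  where
  "is_pullback_along E' B' q E B \<pi> f \<longleftrightarrow>
     continuous_map E' B' q \<and> continuous_map E B \<pi> \<and> continuous_map B' B f \<and>
     (\<exists>F. homeomorphic_map E'
            (subtopology (prod_topology B' E) {(b, e). f b = \<pi> e})
            (\<lambda>x. (q x, F x)))"


section \<open>Configuration spaces\<close>

definition Conf :: "nat \<Rightarrow> 'a topology \<Rightarrow> (nat \<Rightarrow> 'a) topology" where
  "Conf k X = subtopology (product_topology (\<lambda>_. X) {..<k}) {x. inj_on x {..<k}}"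

definition is_composition :: "nat list \<Rightarrow> bool" where
  "is_composition ks \<longleftrightarrow> ks \<noteq> [] \<and> (\<forall>k\<in>set ks. 0 < k)"

definition block :: "nat list \<Rightarrow> nat \<Rightarrow> nat set" where
  "block ks i = {sum_list (take i ks) ..< sum_list (take (Suc i) ks)}"

definition block_sets :: "nat list \<Rightarrow> (nat \<Rightarrow> 'a) \<Rightarrow> 'a set list" where
  "block_sets ks x = map (\<lambda>i. x ` block ks i) [0..<length ks]"

text \<open>
  The quotient of \<open>Conf\<^sub>k(X)\<close>, with \<open>k\<close> the sum of \<open>ks\<close>, by the group of permutations preserving every
  block. The orbit of \<open>x\<close> is represented by the tuple of sets \<open>block_sets ks x\<close>; lemma
  \<open>block_sets_eq_iff\<close> below shows that the fibres of \<open>block_sets ks\<close> are exactly the orbits.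
  In this representation, forgetting the last set is \<open>butlast\<close>.
\<close>

definition Conf_comp :: "nat list \<Rightarrow> 'a topology \<Rightarrow> 'a set list topology" where
  "Conf_comp ks X = quotient_topology (Conf (sum_list ks) X) (block_sets ks)"

lemma topspace_Conf:
  "topspace (Conf k X) = {x \<in> {..<k} \<rightarrow>\<^sub>E topspace X. inj_on x {..<k}}"
  by (auto simp: Conf_def)

lemma sum_list_take_mono:
  fixes ks :: "nat list"
  assumes "i \<le> j"
  shows "sum_list (take i ks) \<le> sum_list (take j ks)"
proof -
  have "take j ks = take i ks @ take (j - i) (drop i ks)"
    using assms by (metis take_add le_add_diff_inverse)
  then show ?thesis by simp
qed

lemma block_subset: "block ks i \<subseteq> {..<sum_list ks}"
proof -
  have "sum_list (take (Suc i) ks) \<le> sum_list ks"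
    by (metis append_take_drop_id le_add1 sum_list_append)
  then show ?thesis by (auto simp: block_def)
qed

lemma block_disjoint:
  assumes "i \<noteq> j"
  shows "block ks i \<inter> block ks j = {}"
  using assms
proof (induction i j rule: linorder_wlog)
  case (le i j)
  then have "sum_list (take (Suc i) ks) \<le> sum_list (take j ks)"
    by (intro sum_list_take_mono) simp
  then show ?case by (auto simp: block_def)
qed blast

lemma block_cover: "a < sum_list ks \<Longrightarrow> \<exists>i<length ks. a \<in> block ks i"
proof (induction ks rule: rev_induct)
  case (snoc k ks)
  show ?case
  proof (cases "a < sum_list ks")
    case True
    then obtain i where "i < length ks" "a \<in> block ks i" using snoc.IH by blast
    then show ?thesis by (intro exI[of _ i]) (auto simp: block_def)
  next
    case False
    then show ?thesis using snoc.prems by (intro exI[of _ "length ks"]) (auto simp: block_def)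
  qed
qed simp

lemma block_sets_eq_iff:
  assumes x: "x \<in> topspace (Conf (sum_list ks) X)" and y: "y \<in> topspace (Conf (sum_list ks) X)"
  shows "block_sets ks x = block_sets ks y \<longleftrightarrow>
    (\<exists>\<sigma>. \<sigma> permutes {..<sum_list ks} \<and> (\<forall>i<length ks. \<sigma> ` block ks i = block ks i) \<and> y = x \<circ> \<sigma>)"
    (is "?L \<longleftrightarrow> ?R")
proof
  assume ?R
  then obtain \<sigma> where \<sigma>: "\<And>i. i < length ks \<Longrightarrow> \<sigma> ` block ks i = block ks i" and "y = x \<circ> \<sigma>"
    by blast
  have "y ` block ks i = x ` block ks i" if "i < length ks" for i
    unfolding \<open>y = x \<circ> \<sigma>\<close> image_comp[symmetric] using \<sigma>[OF that] by simp
  then show ?L by (simp add: block_sets_def)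
next
  assume ?L
  let ?N = "{..<sum_list ks}"
  have ex: "x \<in> extensional ?N" and ey: "y \<in> extensional ?N"
    and ix: "inj_on x ?N" and iy: "inj_on y ?N"
    using x y unfolding topspace_Conf PiE_def by blast+
  have im: "x ` block ks i = y ` block ks i" if "i < length ks" for i
    using arg_cong[OF \<open>?L\<close>, of "\<lambda>Ss. Ss ! i"] that by (simp add: block_sets_def)
  define \<sigma> where "\<sigma> a = (if a \<in> ?N then inv_into ?N x (y a) else a)" for a
  have sig: "\<sigma> a \<in> block ks i \<and> x (\<sigma> a) = y a" if "i < length ks" "a \<in> block ks i" for i a
  proof -
    have "y a \<in> x ` block ks i" using im that by blast
    then obtain b where b: "b \<in> block ks i" "y a = x b" by blast
    then have "\<sigma> a = b"
      using that block_subset[of ks i] ix by (auto simp: \<sigma>_def inv_into_f_f)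
    then show ?thesis using b by simp
  qed
  have sigN: "\<sigma> a \<in> ?N \<and> x (\<sigma> a) = y a" if "a \<in> ?N" for a
    using sig block_cover[of a ks] block_subset that by blast
  have inj: "inj_on \<sigma> ?N"
    using sigN iy by (metis inj_onD inj_onI)
  have "\<sigma> ` ?N = ?N"
    using sigN inj by (intro endo_inj_surj) auto
  then have perm: "\<sigma> permutes ?N"
    using inj by (intro bij_imp_permutes) (auto simp: bij_betw_def \<sigma>_def)
  have "\<sigma> ` block ks i = block ks i" if "i < length ks" for i
    using sig that inj block_subset[of ks i]
    by (intro endo_inj_surj) (auto simp: block_def intro: inj_on_subset)
  moreover have "y = x \<circ> \<sigma>"
  proof
    fix a show "y a = (x \<circ> \<sigma>) a"
      using sigN ex ey by (cases "a \<in> ?N") (auto simp: \<sigma>_def extensional_def)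
  qed
  ultimately show ?R using perm by blast
qed

lemma butlast_block_sets:
  "butlast (block_sets (ks @ [k]) x) = block_sets ks (restrict x {..<sum_list ks})"
proof -
  have "block (ks @ [k]) i = block ks i" if "i < length ks" for i
    using that by (simp add: block_def)
  then have "x ` block (ks @ [k]) i = restrict x {..<sum_list ks} ` block ks i" if "i < length ks" for i
    using that block_subset[of ks i] by (auto simp: image_def)
  then show ?thesis
    by (simp add: block_sets_def)
qed


section \<open>The torus of characters of a free abelian group\<close>

definition free_abelian_of_rank :: "('a, 'b) monoid_scheme \<Rightarrow> nat \<Rightarrow> bool" where
  "free_abelian_of_rank G d \<longleftrightarrow> comm_group G \<and> G \<cong> free_Abelian_group {..<d}"

definition complex_units :: "complex monoid" where
  "complex_units = \<lparr>carrier = - {0}, monoid.mult = (*), one = 1\<rparr>"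

definition torus :: "('a, 'b) monoid_scheme \<Rightarrow> ('a \<Rightarrow> complex) monoid" where
  "torus G =
     \<lparr>carrier = hom G complex_units \<inter> extensional (carrier G),
      monoid.mult = (\<lambda>s t. \<lambda>\<gamma>\<in>carrier G. s \<gamma> * t \<gamma>),
      one = (\<lambda>\<gamma>\<in>carrier G. 1)\<rparr>"

definition torus_top :: "('a, 'b) monoid_scheme \<Rightarrow> ('a \<Rightarrow> complex) topology" where
  "torus_top G = subtopology (product_topology (\<lambda>_. euclidean) (carrier G)) (carrier (torus G))"

definition hypertorus :: "('a, 'b) monoid_scheme \<Rightarrow> 'a \<Rightarrow> ('a \<Rightarrow> complex) set" where
  "hypertorus G \<gamma> = {t \<in> carrier (torus G). t \<gamma> = 1}"

lemma topspace_torus_top [simp]: "topspace (torus_top G) = carrier (torus G)"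
  by (auto simp: torus_top_def torus_def extensional_def)

lemma comm_group_torus:
  assumes "comm_group G"
  shows "comm_group (torus G)"
proof -
  interpret comm_group G by fact
  show ?thesis
  proof (rule comm_groupI)
    fix s assume s: "s \<in> carrier (torus G)"
    have "(\<lambda>\<gamma>\<in>carrier G. inverse (s \<gamma>)) \<in> carrier (torus G)"
      using s by (auto simp: torus_def complex_units_def hom_def Pi_iff)
    moreover have "(\<lambda>\<gamma>\<in>carrier G. inverse (s \<gamma>)) \<otimes>\<^bsub>torus G\<^esub> s = \<one>\<^bsub>torus G\<^esub>"
      using s by (auto simp: torus_def complex_units_def hom_def Pi_iff intro!: restrict_ext)
    ultimately show "\<exists>y\<in>carrier (torus G). y \<otimes>\<^bsub>torus G\<^esub> s = \<one>\<^bsub>torus G\<^esub>" by blast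
  next
    fix s assume "s \<in> carrier (torus G)"
    then show "\<one>\<^bsub>torus G\<^esub> \<otimes>\<^bsub>torus G\<^esub> s = s"
      by (auto simp: torus_def fun_eq_iff extensional_def)
  qed (auto simp: torus_def complex_units_def hom_def Pi_iff fun_eq_iff)
qed


section \<open>Toric arrangements\<close>

definition components_in :: "'a topology \<Rightarrow> 'a set \<Rightarrow> 'a set set" where
  "components_in Z S = connected_components_of (subtopology Z S)"

definition toric_arrangement_of :: "('a, 'b) monoid_scheme \<Rightarrow> 'a set \<Rightarrow> ('a \<Rightarrow> complex) set set" where
  "toric_arrangement_of G \<XX> = (\<Union>\<gamma>\<in>\<XX>. components_in (torus_top G) (hypertorus G \<gamma>))"

text \<open>\<open>presents G \<XX> \<A>\<close>: the finite set \<open>\<XX>\<close> of nontrivial elements of \<open>G\<close> defines the arrangement \<open>\<A>\<close>.\<close>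

definition presents :: "('a, 'b) monoid_scheme \<Rightarrow> 'a set \<Rightarrow> ('a \<Rightarrow> complex) set set \<Rightarrow> bool" where
  "presents G \<XX> \<A> \<longleftrightarrow>
     finite \<XX> \<and> \<XX> \<subseteq> carrier G - {\<one>\<^bsub>G\<^esub>} \<and> \<A> = toric_arrangement_of G \<XX>"

definition toric_arrangement :: "('a, 'b) monoid_scheme \<Rightarrow> ('a \<Rightarrow> complex) set set \<Rightarrow> bool" where
  "toric_arrangement G \<A> \<longleftrightarrow> (\<exists>\<XX>. presents G \<XX> \<A>)"

definition complement_top :: "'a topology \<Rightarrow> 'a set set \<Rightarrow> 'a topology" where
  "complement_top Z \<A> = subtopology Z (topspace Z - \<Union>\<A>)"

lemma Union_components_in: "S \<subseteq> topspace Z \<Longrightarrow> \<Union>(components_in Z S) = S"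
  by (auto simp: components_in_def Union_connected_components_of)

lemma Union_toric_arrangement_of:
  "\<Union>(toric_arrangement_of G \<XX>) = (\<Union>\<gamma>\<in>\<XX>. hypertorus G \<gamma>)"
proof -
  have "\<Union>(components_in (torus_top G) (hypertorus G \<gamma>)) = hypertorus G \<gamma>" for \<gamma>
    by (rule Union_components_in) (auto simp: hypertorus_def)
  moreover have "\<Union>(toric_arrangement_of G \<XX>) =
      (\<Union>\<gamma>\<in>\<XX>. \<Union>(components_in (torus_top G) (hypertorus G \<gamma>)))"
    unfolding toric_arrangement_of_def by blast
  ultimately show ?thesis by simp
qed

text \<open>
  The layers do not depend on the defining set of characters, so it is harmless that \<open>\<XX>\<close> is
  quantified here; this makes the poset of layers a function of the arrangement alone, also for
  the arrangements \<open>\<A>\<^sub>Y\<close> below, which come without chosen characters.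
\<close>

definition layers :: "('a, 'b) monoid_scheme \<Rightarrow> ('a \<Rightarrow> complex) set set \<Rightarrow> ('a \<Rightarrow> complex) set set" where
  "layers G \<A> =
     {C. \<exists>\<XX> S. presents G \<XX> \<A> \<and> S \<subseteq> \<XX> \<and>
          C \<in> components_in (torus_top G) (carrier (torus G) \<inter> (\<Inter>\<gamma>\<in>S. hypertorus G \<gamma>))}"

text \<open>
  The length of a longest chain in a finite nonempty poset of sets; inclusion and reverse inclusion
  have the same chains.
\<close>

definition poset_rank :: "'a set set \<Rightarrow> nat" where
  "poset_rank P = Max {card C - 1 | C. C \<noteq> {} \<and> finite C \<and> subset.chain P C}"


section \<open>Admissible subgroups and ideals\<close>

definition admissible :: "('a, 'b) monoid_scheme \<Rightarrow> ('a \<Rightarrow> complex) set \<Rightarrow> bool" where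
  "admissible G Y \<longleftrightarrow>
     (\<exists>G' G''. subgroup G' G \<and> subgroup G'' G \<and>
        G' \<inter> G'' = {\<one>\<^bsub>G\<^esub>} \<and> G' <#>\<^bsub>G\<^esub> G'' = carrier G \<and>
        free_abelian_of_rank (G\<lparr>carrier := G'\<rparr>) 1 \<and>
        Y = {t \<in> carrier (torus G). \<forall>\<gamma>\<in>G''. t \<gamma> = 1})"

definition torus_proj :: "('a, 'b) monoid_scheme \<Rightarrow> ('a \<Rightarrow> complex) set \<Rightarrow>
    ('a \<Rightarrow> complex) \<Rightarrow> ('a \<Rightarrow> complex) set" where
  "torus_proj G Y t = Y #>\<^bsub>torus G\<^esub> t"

definition torus_quotient_top :: "('a, 'b) monoid_scheme \<Rightarrow> ('a \<Rightarrow> complex) set \<Rightarrow>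
    ('a \<Rightarrow> complex) set topology" where
  "torus_quotient_top G Y = quotient_topology (torus_top G) (torus_proj G Y)"

definition sub_arrangement :: "('a, 'b) monoid_scheme \<Rightarrow> ('a \<Rightarrow> complex) set \<Rightarrow>
    ('a \<Rightarrow> complex) set set \<Rightarrow> ('a \<Rightarrow> complex) set set" where
  "sub_arrangement G Y \<A> = {H \<in> \<A>. \<exists>\<C>. \<C> \<subseteq> rcosets\<^bsub>torus G\<^esub> Y \<and> H = \<Union>\<C>}"

definition quotient_arrangement :: "('a, 'b) monoid_scheme \<Rightarrow> ('a \<Rightarrow> complex) set \<Rightarrow>
    ('a \<Rightarrow> complex) set set \<Rightarrow> ('a \<Rightarrow> complex) set set set" where
  "quotient_arrangement G Y \<A> = (\<lambda>H. torus_proj G Y ` H) ` sub_arrangement G Y \<A>"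

definition M_ideal :: "('a, 'b) monoid_scheme \<Rightarrow> ('a \<Rightarrow> complex) set \<Rightarrow>
    ('a \<Rightarrow> complex) set set \<Rightarrow> bool" where
  "M_ideal G Y \<A> \<longleftrightarrow>
     (\<forall>H\<^sub>1 \<in> \<A> - sub_arrangement G Y \<A>. \<forall>H\<^sub>2 \<in> \<A> - sub_arrangement G Y \<A>. H\<^sub>1 \<noteq> H\<^sub>2 \<longrightarrow>
        (\<forall>X \<in> components_in (torus_top G) (H\<^sub>1 \<inter> H\<^sub>2). \<exists>H\<^sub>3 \<in> sub_arrangement G Y \<A>. X \<subseteq> H\<^sub>3))"

definition TM_ideal :: "('a, 'b) monoid_scheme \<Rightarrow> ('a \<Rightarrow> complex) set \<Rightarrow>
    ('a \<Rightarrow> complex) set set \<Rightarrow> bool" where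
  "TM_ideal G Y \<A> \<longleftrightarrow>
     M_ideal G Y \<A> \<and> (\<forall>H \<in> \<A> - sub_arrangement G Y \<A>. connectedin (torus_top G) (H \<inter> Y))"

definition corank_one :: "('a, 'b) monoid_scheme \<Rightarrow> ('a \<Rightarrow> complex) set \<Rightarrow>
    ('a \<Rightarrow> complex) set set \<Rightarrow> bool" where
  "corank_one G Y \<A> \<longleftrightarrow>
     admissible G Y \<and>
     poset_rank (layers G \<A>) = poset_rank (layers G (sub_arrangement G Y \<A>)) + 1"

end

theory Submission
  imports Defs
begin

text \<open>
  Write \<open>\<Gamma> = \<langle>e\<rangle> \<oplus> N\<close>. A point \<open>t\<close> of the torus is determined by \<open>z = t e\<close> and its restriction to \<open>N\<close>,
  that is, by \<open>z\<close> and its coset modulo \<open>Y\<close>. Every member of the arrangement is a fibre of a primitive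
  character, so a member \<open>H\<close> outside \<open>\<A>\<^sub>Y\<close> has an equation \<open>z ^ m = w b\<close> with \<open>m > 0\<close> and \<open>w\<close> a
  continuous nowhere vanishing function of the coset \<open>b\<close>. The M-ideal condition says that over
  the complement of \<open>\<A>/Y\<close> the root sets of these equations are pairwise disjoint. Hence the fibre of
  the complement of \<open>\<A>\<close> over \<open>b\<close> is the plane without a set \<open>S b\<close> (the roots, together with \<open>0\<close>)
  of constant cardinality \<open>n\<close>, and locally the elements of \<open>S b\<close> can be ordered continuously in \<open>b\<close>.
  So \<open>b \<mapsto> S b\<close> is the classifying map to the unordered configuration space, and (1) holds with the
  one-block composition \<open>[n]\<close>. Under the TM-ideal condition every \<open>m\<close> is \<open>1\<close>, because the connected set \<open>H \<inter> Y\<close>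
  has \<open>m\<close> points; then each root is itself a continuous function of \<open>b\<close>, and \<open>S b\<close> is ordered globally.
\<close>

section \<open>Pullbacks of configuration bundles\<close>

lemma continuous_map_Conf_iff:
  "continuous_map B (Conf n X) f \<longleftrightarrow>
     (\<forall>k<n. continuous_map B X (\<lambda>b. f b k)) \<and>
     (\<forall>b\<in>topspace B. f b \<in> extensional {..<n} \<and> inj_on (f b) {..<n})"
  unfolding Conf_def continuous_map_in_subtopology continuous_map_componentwise
  by auto

lemma continuous_map_Conf_eval: "k < n \<Longrightarrow> continuous_map (Conf n X) X (\<lambda>x. x k)"
  using continuous_map_Conf_iff[of "Conf n X" n X "\<lambda>x. x"] by simp

lemma continuous_map_Conf_restrict:
  "continuous_map (Conf (n + 1) X) (Conf n X) (\<lambda>x. restrict x {..<n})"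
  unfolding continuous_map_Conf_iff
proof (intro conjI allI impI ballI)
  fix k assume "k < n"
  then show "continuous_map (Conf (n + 1) X) X (\<lambda>x. restrict x {..<n} k)"
    using continuous_map_Conf_eval[of k "n + 1" X] by simp
qed (auto simp: topspace_Conf inj_on_def)

lemma quotient_map_Conf_comp: "sum_list ks = k \<Longrightarrow> quotient_map (Conf k X) (Conf_comp ks X) (block_sets ks)"
  unfolding Conf_comp_def using quotient_map_quotient_topology by blast

lemma block_sets_single: "block_sets [n] x = [x ` {..<n}]"
  by (simp add: block_sets_def block_def atLeast0LessThan)

lemma block_sets_pair: "block_sets [n, 1] x = [x ` {..<n}, {x n}]"
proof -
  have "{n..<Suc n} = {n}" by auto
  then show ?thesis
    by (simp add: block_sets_def block_def atLeast0LessThan upt_rec)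
qed

text \<open>A map out of a quotient is continuous once its composite with the quotient map is; on
  ordered configurations, forgetting the last set becomes restriction to the first \<open>n\<close>
  coordinates.\<close>

lemma continuous_map_butlast:
  "continuous_map (Conf_comp [n, 1] X) (Conf_comp [n] X) butlast"
proof (rule continuous_compose_quotient_map)
  show "quotient_map (Conf (n + 1) X) (Conf_comp [n, 1] X) (block_sets [n, 1])"
    by (rule quotient_map_Conf_comp) simp
  have "continuous_map (Conf (n + 1) X) (Conf_comp [n] X) (block_sets [n] \<circ> (\<lambda>x. restrict x {..<n}))"
    by (intro continuous_map_compose[OF continuous_map_Conf_restrict]
          quotient_imp_continuous_map quotient_map_Conf_comp) simp
  moreover have "butlast \<circ> block_sets [n, 1] = block_sets [n] \<circ> (\<lambda>x. restrict x {..<n})"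
    using butlast_block_sets[of "[n]" 1] by (auto simp: fun_eq_iff)
  ultimately show "continuous_map (Conf (n + 1) X) (Conf_comp [n] X) (butlast \<circ> block_sets [n, 1])"
    by metis
qed

text \<open>Supplies the inverse in the pullback argument. The last set is a singleton, so on
  ordered configurations this map is evaluation at index \<open>n\<close>.\<close>

lemma continuous_map_last_point:
  "continuous_map (Conf_comp [n, 1] X) X (\<lambda>e. the_elem (last e))"
proof (rule continuous_compose_quotient_map)
  show "quotient_map (Conf (n + 1) X) (Conf_comp [n, 1] X) (block_sets [n, 1])"
    by (rule quotient_map_Conf_comp) simp
  have eq: "(\<lambda>e. the_elem (last e)) \<circ> block_sets [n, 1] = (\<lambda>x::nat \<Rightarrow> 'a. x n)"
    unfolding o_def block_sets_pair by simp
  show "continuous_map (Conf (n + 1) X) X ((\<lambda>e. the_elem (last e)) \<circ> block_sets [n, 1])"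
    unfolding eq by (rule continuous_map_Conf_eval) simp
qed

lemma continuous_map_locally:
  assumes "\<And>x. x \<in> topspace X \<Longrightarrow> \<exists>U. openin X U \<and> x \<in> U \<and> continuous_map (subtopology X U) Y f"
  shows "continuous_map X Y f"
proof -
  obtain U where U: "\<And>x. x \<in> topspace X \<Longrightarrow> openin X (U x) \<and> x \<in> U x \<and> continuous_map (subtopology X (U x)) Y f"
    using assms by metis
  show ?thesis
    by (rule pasting_lemma[where I = "topspace X" and T = U and f = "\<lambda>_. f"]) (use U in auto)
qed

text \<open>Index \<open>n\<close> is the first one beyond \<open>{..<n}\<close>, so the update
  adjoins one point to an ordered configuration; avoiding the old points is what keeps the tuple
  injective.\<close>

lemma continuous_map_Conf_extend:
  assumes s: "continuous_map Z (Conf n X) s" and c: "continuous_map Z X c"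
    and new: "\<And>z. z \<in> topspace Z \<Longrightarrow> c z \<notin> s z ` {..<n}"
  shows "continuous_map Z (Conf (n + 1) X) (\<lambda>z. (s z)(n := c z))"
  unfolding continuous_map_Conf_iff
proof (intro conjI allI impI ballI)
  fix k assume "k < n + 1"
  then show "continuous_map Z X (\<lambda>z. ((s z)(n := c z)) k)"
    using s c by (cases "k = n") (auto simp: continuous_map_Conf_iff)
next
  fix z assume z: "z \<in> topspace Z"
  then have "inj_on (s z) {..<n}" "s z \<in> extensional {..<n}"
    using s by (auto simp: continuous_map_Conf_iff)
  then show "inj_on ((s z)(n := c z)) {..<n + 1}"
    using new[OF z] by (simp add: lessThan_Suc inj_on_fun_updI)
  show "(s z)(n := c z) \<in> extensional {..<n + 1}"
    using \<open>s z \<in> extensional {..<n}\<close> by (auto simp: extensional_def)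
qed

text \<open>A point of the fibre product over \<open>b\<close> has the form
  \<open>[S b, {z}]\<close> with \<open>z\<close> outside \<open>S b\<close>, so the fibre product
  is the complement of the family \<open>S\<close> in \<open>B \<times> X\<close>. Local orderings
  of \<open>S b\<close> suffice because \<open>[S b]\<close> and \<open>[S b, {z}]\<close> forget
  the ordering and continuity is a local property.\<close>

lemma pullback_Conf_comp:
  assumes loc: "\<And>b. b \<in> topspace B \<Longrightarrow> \<exists>U s. openin B U \<and> b \<in> U \<and>
      continuous_map (subtopology B U) (Conf n X) s \<and> (\<forall>b'\<in>U. s b' ` {..<n} = S b')"
    and homeo: "homeomorphic_map E' (subtopology (prod_topology B X) {(b, z). z \<notin> S b}) (\<lambda>x. (q x, c x))"
  shows "is_pullback_along E' B q (Conf_comp [n, 1] X) (Conf_comp [n] X) butlast (\<lambda>b. [S b])"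
proof -
  define D where "D = subtopology (prod_topology B X) {(b, z). z \<notin> S b}"
  define P where "P = subtopology (prod_topology B (Conf_comp [n, 1] X)) {(b, e). [S b] = butlast e}"
  have quot: "continuous_map (Conf (n + 1) X) (Conf_comp [n, 1] X) (block_sets [n, 1])"
    by (intro quotient_imp_continuous_map quotient_map_Conf_comp) simp
  have cD: "continuous_map D B fst" "continuous_map D X snd"
    unfolding D_def by (auto intro: continuous_map_from_subtopology continuous_map_fst continuous_map_snd)
  have q: "continuous_map E' B q"
    using continuous_map_compose[OF homeomorphic_imp_continuous_map[OF homeo[folded D_def]] cD(1)]
    by (simp add: o_def)
  have S: "continuous_map B (Conf_comp [n] X) (\<lambda>b. [S b])"
  proof (rule continuous_map_locally)
    fix b assume "b \<in> topspace B"
    from loc[OF this] obtain U s where U: "openin B U" "b \<in> U" "continuous_map (subtopology B U) (Conf n X) s"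
        "\<And>b'. b' \<in> U \<Longrightarrow> s b' ` {..<n} = S b'"
      by auto
    have "continuous_map (subtopology B U) (Conf_comp [n] X) (block_sets [n] \<circ> s)"
      by (intro continuous_map_compose[OF U(3)] quotient_imp_continuous_map quotient_map_Conf_comp) simp
    then have "continuous_map (subtopology B U) (Conf_comp [n] X) (\<lambda>b. [S b])"
      by (rule continuous_map_eq) (use U in \<open>auto simp: block_sets_single\<close>)
    then show "\<exists>U. openin B U \<and> b \<in> U \<and> continuous_map (subtopology B U) (Conf_comp [n] X) (\<lambda>b. [S b])"
      using U by blast
  qed
  have F: "continuous_map D (Conf_comp [n, 1] X) (\<lambda>y. [S (fst y), {snd y}])"
  proof (rule continuous_map_locally)
    fix x assume x: "x \<in> topspace D"
    then have "fst x \<in> topspace B" by (auto simp: D_def)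
    from loc[OF this] obtain U s where U: "openin B U" "fst x \<in> U" "continuous_map (subtopology B U) (Conf n X) s"
        "\<And>b'. b' \<in> U \<Longrightarrow> s b' ` {..<n} = S b'"
      by auto
    define V where "V = {y \<in> topspace D. fst y \<in> U}"
    have "openin D V"
      unfolding V_def using cD(1) U(1) by (rule openin_continuous_map_preimage)
    have cs: "continuous_map (subtopology D V) (Conf n X) (s \<circ> fst)"
    proof (rule continuous_map_compose[OF _ U(3)])
      show "continuous_map (subtopology D V) (subtopology B U) fst"
        unfolding continuous_map_in_subtopology
        using continuous_map_from_subtopology[OF cD(1)] by (auto simp: V_def)
    qed
    have "continuous_map (subtopology D V) (Conf (n + 1) X) (\<lambda>y. ((s \<circ> fst) y)(n := snd y))"
    proof (rule continuous_map_Conf_extend[OF cs continuous_map_from_subtopology[OF cD(2)]])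
      fix y assume "y \<in> topspace (subtopology D V)"
      then have "fst y \<in> U" "snd y \<notin> S (fst y)" by (auto simp: V_def D_def)
      then show "snd y \<notin> (s \<circ> fst) y ` {..<n}"
        using U(4)[of "fst y"] by simp
    qed
    from continuous_map_compose[OF this quot]
    have "continuous_map (subtopology D V) (Conf_comp [n, 1] X) (\<lambda>y. [S (fst y), {snd y}])"
    proof (rule continuous_map_eq)
      fix y assume "y \<in> topspace (subtopology D V)"
      then have "fst y \<in> U" by (auto simp: V_def)
      then show "(block_sets [n, 1] \<circ> (\<lambda>y. ((s \<circ> fst) y)(n := snd y))) y = [S (fst y), {snd y}]"
        using U(4)[of "fst y"] by (simp add: block_sets_pair del: One_nat_def)
    qed
    then show "\<exists>U. openin D U \<and> x \<in> U \<and> continuous_map (subtopology D U) (Conf_comp [n, 1] X) (\<lambda>y. [S (fst y), {snd y}])"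
      using \<open>openin D V\<close> x U(2) by (auto simp: V_def)
  qed
  have "homeomorphic_maps D P (\<lambda>y. (fst y, [S (fst y), {snd y}])) (\<lambda>y. (fst y, the_elem (last (snd y))))"
    unfolding homeomorphic_maps_def
  proof (intro conjI ballI)
    have "continuous_map D (prod_topology B (Conf_comp [n, 1] X)) (\<lambda>y. (fst y, [S (fst y), {snd y}]))"
      using cD F by (auto simp: continuous_map_pairwise o_def)
    then show "continuous_map D P (\<lambda>y. (fst y, [S (fst y), {snd y}]))"
      by (auto simp: P_def continuous_map_in_subtopology)
    have "continuous_map P (Conf_comp [n, 1] X) snd"
      unfolding P_def by (rule continuous_map_from_subtopology[OF continuous_map_snd])
    from continuous_map_compose[OF this continuous_map_last_point]
    have "continuous_map P X (\<lambda>y. the_elem (last (snd y)))"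
      unfolding o_def .
    moreover have "continuous_map P B fst"
      unfolding P_def by (auto intro: continuous_map_from_subtopology continuous_map_fst)
    \<comment> \<open>A representing tuple is injective on \<open>n + 1\<close> indices, so its last
      entry lies outside the image of the first \<open>n\<close>.\<close>
    moreover have "the_elem (last e) \<notin> S b" if "(b, e) \<in> topspace P" for b e
    proof -
      have "e \<in> topspace (Conf_comp [n, 1] X)" and e: "[S b] = butlast e" using that by (auto simp: P_def)
      then obtain x where x: "x \<in> topspace (Conf (n + 1) X)" "e = block_sets [n, 1] x"
        by (auto simp: Conf_comp_def)
      then have "S b = x ` {..<n}" "last e = {x n}" using e by (simp_all add: block_sets_pair del: One_nat_def)
      moreover have "inj_on x {..<n + 1}" using x by (auto simp: topspace_Conf)
      then have "x n \<notin> x ` {..<n}"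
        using inj_on_image_mem_iff[of x "{..<n + 1}" n "{..<n}"] by auto
      ultimately show ?thesis by simp
    qed
    ultimately show "continuous_map P D (\<lambda>y. (fst y, the_elem (last (snd y))))"
      by (auto simp: D_def continuous_map_in_subtopology continuous_map_pairwise o_def)
  next
    fix y assume "y \<in> topspace P"
    then obtain b x where "y = (b, block_sets [n, 1] x)" "[S b] = butlast (block_sets [n, 1] x)"
      by (auto simp: P_def Conf_comp_def)
    then show "(fst (fst y, the_elem (last (snd y))),
           [S (fst (fst y, the_elem (last (snd y)))), {snd (fst y, the_elem (last (snd y)))}]) = y"
      by (auto simp: block_sets_pair[simplified])
  qed auto
  then have "homeomorphic_map D P (\<lambda>y. (fst y, [S (fst y), {snd y}]))"
    unfolding homeomorphic_map_maps by blast
  from homeomorphic_map_compose[OF homeo[folded D_def] this]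
  have "homeomorphic_map E' P (\<lambda>x. (q x, [S (q x), {c x}]))"
    by (simp add: o_def)
  then have "\<exists>F. homeomorphic_map E' P (\<lambda>x. (q x, F x))"
    by (rule exI[where P = "\<lambda>F. homeomorphic_map E' P (\<lambda>x. (q x, F x))"])
  then show ?thesis
    unfolding is_pullback_along_def P_def using q S continuous_map_butlast by blast
qed

text \<open>With a global ordering \<open>s\<close>, a point of the fibre product over
  \<open>b\<close> is \<open>s b\<close> with one further entry, hence is recovered from its value
  at index \<open>n\<close>.\<close>

lemma pullback_Conf:
  assumes s: "continuous_map B (Conf n X) s" and S: "\<And>b. b \<in> topspace B \<Longrightarrow> s b ` {..<n} = S b"
    and homeo: "homeomorphic_map E' (subtopology (prod_topology B X) {(b, z). z \<notin> S b}) (\<lambda>x. (q x, c x))"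
  shows "is_pullback_along E' B q (Conf (n + 1) X) (Conf n X) (\<lambda>x. restrict x {..<n}) s"
proof -
  define D where "D = subtopology (prod_topology B X) {(b, z). z \<notin> S b}"
  define P where "P = subtopology (prod_topology B (Conf (n + 1) X)) {(b, e). s b = restrict e {..<n}}"
  have cD: "continuous_map D B fst" "continuous_map D X snd"
    unfolding D_def by (auto intro: continuous_map_from_subtopology continuous_map_fst continuous_map_snd)
  have q: "continuous_map E' B q"
    using continuous_map_compose[OF homeomorphic_imp_continuous_map[OF homeo[folded D_def]] cD(1)]
    by (simp add: o_def)
  have F: "continuous_map D (Conf (n + 1) X) (\<lambda>y. ((s \<circ> fst) y)(n := snd y))"
  proof (rule continuous_map_Conf_extend[OF continuous_map_compose[OF cD(1) s] cD(2)])
    fix y assume "y \<in> topspace D"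
    then have "fst y \<in> topspace B" "snd y \<notin> S (fst y)" by (auto simp: D_def)
    then show "snd y \<notin> (s \<circ> fst) y ` {..<n}"
      using S[of "fst y"] by simp
  qed
  have ext: "s b \<in> extensional {..<n}" if "b \<in> topspace B" for b
    using s that by (auto simp: continuous_map_Conf_iff)
  have "homeomorphic_maps D P (\<lambda>y. (fst y, (s (fst y))(n := snd y))) (\<lambda>y. (fst y, snd y n))"
    unfolding homeomorphic_maps_def
  proof (intro conjI ballI)
    have "continuous_map D (prod_topology B (Conf (n + 1) X)) (\<lambda>y. (fst y, (s (fst y))(n := snd y)))"
      using cD F by (auto simp: continuous_map_pairwise o_def)
    \<comment> \<open>Both sides take the default value off \<open>{..<n}\<close>, since
      \<open>s b\<close> is extensional; at index \<open>n\<close> the restriction undoes the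
      update.\<close>
    moreover have "s b = restrict ((s b)(n := z)) {..<n}" if "b \<in> topspace B" for b z
      using ext[OF that] by (auto simp: extensional_def fun_eq_iff restrict_def)
    ultimately show "continuous_map D P (\<lambda>y. (fst y, (s (fst y))(n := snd y)))"
      by (auto simp: P_def continuous_map_in_subtopology D_def)
    have "continuous_map P X (\<lambda>y. snd y n)"
      using continuous_map_compose[OF continuous_map_from_subtopology[OF continuous_map_snd] continuous_map_Conf_eval[of n "n + 1" X]]
      unfolding P_def by (simp add: o_def)
    moreover have "continuous_map P B fst"
      unfolding P_def by (auto intro: continuous_map_from_subtopology continuous_map_fst)
    moreover have "e n \<notin> S b" if "(b, e) \<in> topspace P" for b e
    proof -
      have "b \<in> topspace B" "s b = restrict e {..<n}" "inj_on e {..<n + 1}"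
        using that by (auto simp: P_def topspace_Conf)
      moreover from this have "e n \<notin> e ` {..<n}"
        using inj_on_image_mem_iff[of e "{..<n + 1}" n "{..<n}"] by auto
      ultimately show ?thesis using S[of b] by simp
    qed
    ultimately show "continuous_map P D (\<lambda>y. (fst y, snd y n))"
      by (auto simp: D_def continuous_map_in_subtopology continuous_map_pairwise o_def)
  next
    fix y assume "y \<in> topspace P"
    then obtain b e where "y = (b, e)" "s b = restrict e {..<n}" "e \<in> extensional {..<n + 1}"
      by (auto simp: P_def topspace_Conf PiE_def)
    then show "(fst (fst y, snd y n), (s (fst (fst y, snd y n)))(n := snd (fst y, snd y n))) = y"
      by (auto simp: fun_eq_iff extensional_def)
  qed auto
  then have "homeomorphic_map D P (\<lambda>y. (fst y, (s (fst y))(n := snd y)))"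
    unfolding homeomorphic_map_maps by blast
  from homeomorphic_map_compose[OF homeo[folded D_def] this]
  have "homeomorphic_map E' P (\<lambda>x. (q x, (s (q x))(n := c x)))"
    by (simp add: o_def)
  then have "\<exists>F. homeomorphic_map E' P (\<lambda>x. (q x, F x))"
    by (rule exI[where P = "\<lambda>F. homeomorphic_map E' P (\<lambda>x. (q x, F x))"])
  then show ?thesis
    unfolding is_pullback_along_def P_def using q s continuous_map_Conf_restrict by blast
qed

section \<open>Root sets of binomial equations\<close>

text \<open>The origin is adjoined because the fibre coordinate takes nonzero values while the
  configurations live in the whole plane: the puncture at \<open>0\<close> counts as one more
  point.\<close>

definition root_set :: "'i set \<Rightarrow> ('i \<Rightarrow> nat) \<Rightarrow> ('i \<Rightarrow> 'b \<Rightarrow> complex) \<Rightarrow> 'b \<Rightarrow> complex set" where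
  "root_set I m w b = insert 0 (\<Union>i\<in>I. {z. z ^ m i = w i b})"

text \<open>The final clause is the analytic form of the M-ideal condition: distinct equations never
  share a root. Nonvanishing of \<open>w i b\<close> keeps the roots of a single equation simple and
  away from \<open>0\<close>.\<close>

definition separated_roots :: "'b topology \<Rightarrow> 'i set \<Rightarrow> ('i \<Rightarrow> nat) \<Rightarrow> ('i \<Rightarrow> 'b \<Rightarrow> complex) \<Rightarrow> bool" where
  "separated_roots B I m w \<longleftrightarrow> finite I \<and>
     (\<forall>i\<in>I. 0 < m i \<and> continuous_map B euclidean (w i)) \<and>
     (\<forall>b\<in>topspace B. (\<forall>i\<in>I. w i b \<noteq> 0) \<and>
        (\<forall>i\<in>I. \<forall>j\<in>I. \<forall>z. z ^ m i = w i b \<and> z ^ m j = w j b \<longrightarrow> i = j))"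

text \<open>The equation with index \<open>i\<close> has exactly \<open>m i\<close> roots, its
  right-hand side being nonzero; the sets of roots are disjoint and miss \<open>0\<close>, which
  accounts for the successor.\<close>

lemma card_root_set:
  assumes "separated_roots B I m w" "b \<in> topspace B"
  shows "finite (root_set I m w b)" "card (root_set I m w b) = Suc (\<Sum>i\<in>I. m i)"
proof -
  have fin: "finite I" and pos: "\<And>i. i \<in> I \<Longrightarrow> 0 < m i" and nz: "\<And>i. i \<in> I \<Longrightarrow> w i b \<noteq> 0"
    and disj: "\<And>i j z. \<lbrakk>i \<in> I; j \<in> I; z ^ m i = w i b; z ^ m j = w j b\<rbrakk> \<Longrightarrow> i = j"
    using assms unfolding separated_roots_def by blast+
  have fin_roots: "finite {z. z ^ m i = w i b}" if "i \<in> I" for i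
    using card_nth_roots[OF nz[OF that] pos[OF that]] pos[OF that] card_ge_0_finite by metis
  then show "finite (root_set I m w b)"
    using fin by (simp add: root_set_def)
  have "0 \<notin> (\<Union>i\<in>I. {z. z ^ m i = w i b})"
    using nz pos by (auto simp: zero_power)
  moreover have "card (\<Union>i\<in>I. {z. z ^ m i = w i b}) = (\<Sum>i\<in>I. card {z. z ^ m i = w i b})"
    using fin fin_roots disj by (intro card_UN_disjoint) blast+
  moreover have "(\<Sum>i\<in>I. card {z. z ^ m i = w i b}) = (\<Sum>i\<in>I. m i)"
    using card_nth_roots nz pos by (intro sum.cong) auto
  ultimately show "card (root_set I m w b) = Suc (\<Sum>i\<in>I. m i)"
    unfolding root_set_def using fin fin_roots by (subst card_insert_disjoint) auto
qed

text \<open>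
  Near \<open>b\<^sub>0\<close> the root \<open>z\<close> of \<open>z ^ m = w b\<^sub>0\<close> moves along the explicit branch
  \<open>z * exp (Ln (w b / w b\<^sub>0) / m)\<close>.
\<close>

lemma root_set_local_ordering:
  assumes sep: "separated_roots B I m w" and b0: "b0 \<in> topspace B"
    and n: "n = Suc (\<Sum>i\<in>I. m i)"
  shows "\<exists>U s. openin B U \<and> b0 \<in> U \<and> continuous_map (subtopology B U) (Conf n euclidean) s \<and>
    (\<forall>b\<in>U. s b ` {..<n} = root_set I m w b)"
proof -
  have fin: "finite I" and pos: "\<And>i. i \<in> I \<Longrightarrow> 0 < m i"
    and cont: "\<And>i. i \<in> I \<Longrightarrow> continuous_map B euclidean (w i)"
    and nz: "\<And>i b. i \<in> I \<Longrightarrow> b \<in> topspace B \<Longrightarrow> w i b \<noteq> 0"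
    and disj: "\<And>i j b z. \<lbrakk>b \<in> topspace B; i \<in> I; j \<in> I; z ^ m i = w i b; z ^ m j = w j b\<rbrakk> \<Longrightarrow> i = j"
    using sep unfolding separated_roots_def by blast+
  define D where "D i = {u. 0 < Re (u / w i b0)}" for i
  define U where "U = (\<Inter>i\<in>I. {b \<in> topspace B. w i b \<in> D i}) \<inter> topspace B"
  define c where "c i u = exp (Ln (u / w i b0) / of_nat (m i))" for i u
  \<comment> \<open>The sets of roots over \<open>b0\<close> are disjoint, so a nonzero element of
    the root set has a unique index and the choice is determined.\<close>
  define ix where "ix z = (SOME i. i \<in> I \<and> z ^ m i = w i b0)" for z
  define \<rho> where "\<rho> z b = (if z = 0 then 0 else z * c (ix z) (w (ix z) b))" for z b
  have ix: "ix z = i" if "i \<in> I" "z ^ m i = w i b0" for i z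
    unfolding ix_def using that disj[OF b0] by (intro some_equality) auto
  have c: "c i (w i b) ^ m i = w i b / w i b0" "c i (w i b) \<noteq> 0" if "i \<in> I" "b \<in> topspace B" for i b
  proof -
    have "c i (w i b) ^ m i = exp (of_nat (m i) * (Ln (w i b / w i b0) / of_nat (m i)))"
      unfolding c_def by (rule exp_of_nat_mult[symmetric])
    then show "c i (w i b) ^ m i = w i b / w i b0"
      using pos[OF that(1)] nz[OF that(1)] that(2) b0 by simp
  qed (simp add: c_def)
  have openD: "open (D i)" if "i \<in> I" for i
    unfolding D_def by (intro open_Collect_less continuous_intros) (simp add: nz[OF that b0])
  then have "openin B U"
    unfolding U_def using fin cont openD
    by (intro openin_INT) (auto intro!: openin_continuous_map_preimage[of B euclidean])
  have b0U: "b0 \<in> U"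
    using b0 nz by (auto simp: U_def D_def)
  \<comment> \<open>Multiplication by \<open>c i (w i b)\<close> carries the solutions for
    \<open>w i b0\<close> to those for \<open>w i b\<close>, division by it goes back, and
    \<open>0\<close> is fixed.\<close>
  have image: "(\<lambda>z. \<rho> z b) ` root_set I m w b0 = root_set I m w b" if "b \<in> topspace B" for b
  proof (intro subset_antisym subsetI)
    fix y assume "y \<in> (\<lambda>z. \<rho> z b) ` root_set I m w b0"
    then obtain z where z: "z \<in> root_set I m w b0" "y = \<rho> z b" by blast
    show "y \<in> root_set I m w b"
    proof (cases "z = 0")
      case False
      then obtain i where i: "i \<in> I" "z ^ m i = w i b0" using z by (auto simp: root_set_def)
      then have "y ^ m i = w i b"
        using z(2) False ix[OF i] c[OF i(1) that] nz[OF i(1) b0] by (simp add: \<rho>_def power_mult_distrib)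
      then show ?thesis using i by (auto simp: root_set_def)
    qed (use z in \<open>auto simp: \<rho>_def root_set_def\<close>)
  next
    fix y assume y: "y \<in> root_set I m w b"
    show "y \<in> (\<lambda>z. \<rho> z b) ` root_set I m w b0"
    proof (cases "y = 0")
      case True
      then have "y = \<rho> 0 b" by (simp add: \<rho>_def)
      then show ?thesis by (auto simp: root_set_def)
    next
      case False
      then obtain i where i: "i \<in> I" "y ^ m i = w i b" using y by (auto simp: root_set_def)
      define z where "z = y / c i (w i b)"
      have z: "z ^ m i = w i b0"
        using i c[OF i(1) that] nz[OF i(1) that] nz[OF i(1) b0] by (simp add: z_def power_divide)
      moreover have "y = \<rho> z b"
        using False ix[OF i(1) z] c[OF i(1) that] by (simp add: \<rho>_def z_def)
      ultimately show ?thesis using i by (auto simp: root_set_def)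
    qed
  qed
  obtain h where h: "bij_betw h {..<n} (root_set I m w b0)"
    using ex_bij_betw_nat_finite[OF card_root_set(1)[OF sep b0]] card_root_set(2)[OF sep b0] n
    by (auto simp: atLeast0LessThan)
  define s where "s b = (\<lambda>k\<in>{..<n}. \<rho> (h k) b)" for b
  have s_image: "s b ` {..<n} = root_set I m w b" if "b \<in> topspace B" for b
  proof -
    have "s b ` {..<n} = (\<lambda>z. \<rho> z b) ` h ` {..<n}" by (auto simp: s_def)
    then show ?thesis using h image[OF that] by (simp add: bij_betw_def)
  qed
  \<comment> \<open>An enumeration of an \<open>n\<close>-element set by \<open>n\<close> indices
    cannot repeat a value, so injectivity follows by counting.\<close>
  have s_inj: "inj_on (s b) {..<n}" if "b \<in> topspace B" for b
    using s_image[OF that] card_root_set[OF sep that] n by (intro eq_card_imp_inj_on) auto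
  have cont_\<rho>: "continuous_map (subtopology B U) euclidean (\<rho> z)" if z: "z \<in> root_set I m w b0" for z
  proof (cases "z = 0")
    case True
    then show ?thesis by (simp add: \<rho>_def[abs_def])
  next
    case False
    then obtain i where i: "i \<in> I" "z ^ m i = w i b0" using z by (auto simp: root_set_def)
    have "continuous_on (D i) (\<lambda>u. z * c i u)"
      unfolding c_def D_def using pos[OF i(1)]
      by (intro continuous_intros) (auto simp: complex_nonpos_Reals_iff nz[OF i(1) b0])
    then have "continuous_map (top_of_set (D i)) euclidean (\<lambda>u. z * c i u)" by simp
    moreover have "continuous_map (subtopology B U) (top_of_set (D i)) (w i)"
      unfolding continuous_map_in_subtopology
      using continuous_map_from_subtopology[OF cont[OF i(1)]] i(1) by (auto simp: U_def)
    ultimately have "continuous_map (subtopology B U) euclidean ((\<lambda>u. z * c i u) \<circ> w i)"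
      by (metis continuous_map_compose)
    moreover have "\<rho> z = (\<lambda>u. z * c i u) \<circ> w i"
      using False ix[OF i] by (auto simp: \<rho>_def fun_eq_iff)
    ultimately show ?thesis by simp
  qed
  have "continuous_map (subtopology B U) (Conf n euclidean) s"
    unfolding continuous_map_Conf_iff
  proof (intro conjI allI impI ballI)
    fix k assume k: "k < n"
    then have "h k \<in> root_set I m w b0" using h by (auto simp: bij_betw_def)
    then show "continuous_map (subtopology B U) euclidean (\<lambda>b. s b k)"
      using cont_\<rho> k by (simp add: s_def)
  qed (use s_inj in \<open>auto simp: s_def\<close>)
  moreover have "\<forall>b\<in>U. s b ` {..<n} = root_set I m w b"
    using s_image by (auto simp: U_def)
  ultimately show ?thesis using \<open>openin B U\<close> b0U by blast
qed

text \<open>An equation of exponent \<open>1\<close> has the single root \<open>w i b\<close>, which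
  is continuous on all of \<open>B\<close>; a fixed enumeration of \<open>I\<close> then orders the
  roots, with the origin in the last place \<open>card I\<close>.\<close>

lemma root_set_global_ordering:
  assumes sep: "separated_roots B I m w" and one: "\<And>i. i \<in> I \<Longrightarrow> m i = 1"
    and n: "n = Suc (\<Sum>i\<in>I. m i)"
  obtains s where "continuous_map B (Conf n euclidean) s"
    and "\<And>b. b \<in> topspace B \<Longrightarrow> s b ` {..<n} = root_set I m w b"
proof -
  have fin: "finite I" and cont: "\<And>i. i \<in> I \<Longrightarrow> continuous_map B euclidean (w i)"
    using sep unfolding separated_roots_def by blast+
  have nI: "n = Suc (card I)" using n one by simp
  obtain h where h: "bij_betw h {..<card I} I"
    using ex_bij_betw_nat_finite[OF fin] by (auto simp: atLeast0LessThan)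
  define s where "s b = (\<lambda>k\<in>{..<n}. if k = card I then 0 else w (h k) b)" for b
  have s_image: "s b ` {..<n} = root_set I m w b" for b
  proof -
    have "s b ` {..<n} = insert 0 ((\<lambda>i. w i b) ` h ` {..<card I})"
      unfolding nI lessThan_Suc s_def by (auto simp: image_iff)
    then show ?thesis using h one by (auto simp: bij_betw_def root_set_def)
  qed
  have s_inj: "inj_on (s b) {..<n}" if "b \<in> topspace B" for b
    using s_image[of b] card_root_set[OF sep that] n by (intro eq_card_imp_inj_on) auto
  have "continuous_map B (Conf n euclidean) s"
    unfolding continuous_map_Conf_iff
  proof (intro conjI allI impI ballI)
    fix k assume k: "k < n"
    show "continuous_map B euclidean (\<lambda>b. s b k)"
    proof (cases "k = card I")
      case False
      then have "h k \<in> I" using h k nI by (auto simp: bij_betw_def)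
      then show ?thesis using cont[of "h k"] False k by (simp add: s_def)
    qed (use k in \<open>simp add: s_def\<close>)
  qed (use s_inj in \<open>auto simp: s_def\<close>)
  then show thesis using that s_image by blast
qed

section \<open>Components of hypertori\<close>

lemma carrier_torus_iff:
  "t \<in> carrier (torus G) \<longleftrightarrow> t \<in> extensional (carrier G) \<and> (\<forall>x\<in>carrier G. t x \<noteq> 0) \<and>
     (\<forall>x\<in>carrier G. \<forall>y\<in>carrier G. t (x \<otimes>\<^bsub>G\<^esub> y) = t x * t y)"
  by (auto simp: torus_def hom_def complex_units_def)

lemma torus_mult: "\<lbrakk>t \<in> carrier (torus G); x \<in> carrier G; y \<in> carrier G\<rbrakk> \<Longrightarrow> t (x \<otimes>\<^bsub>G\<^esub> y) = t x * t y"
  and torus_nonzero: "\<lbrakk>t \<in> carrier (torus G); x \<in> carrier G\<rbrakk> \<Longrightarrow> t x \<noteq> 0"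
  by (auto simp: carrier_torus_iff)

lemma torus_eqI:
  "\<lbrakk>s \<in> carrier (torus G); t \<in> carrier (torus G); \<And>x. x \<in> carrier G \<Longrightarrow> s x = t x\<rbrakk> \<Longrightarrow> s = t"
  by (rule extensionalityI[of _ "carrier G"]) (auto simp: carrier_torus_iff)

lemma (in group) torus_one: "t \<in> carrier (torus G) \<Longrightarrow> t \<one> = 1"
  using torus_mult[of t G \<one> \<one>] torus_nonzero[of t G \<one>] by simp

lemma (in group) torus_inv: "\<lbrakk>t \<in> carrier (torus G); x \<in> carrier G\<rbrakk> \<Longrightarrow> t (inv x) = inverse (t x)"
  using torus_mult[of t G x "inv x"] torus_one[of t] inverse_unique[of "t x" "t (inv x)"] by simp

lemma (in group) torus_nat_pow:
  assumes "t \<in> carrier (torus G)" "x \<in> carrier G"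
  shows "t (x [^] (n::nat)) = t x ^ n"
  by (induction n) (simp_all add: assms(2) torus_one[OF assms(1)] torus_mult[OF assms(1)])

lemma (in group) torus_int_pow:
  assumes "t \<in> carrier (torus G)" "x \<in> carrier G"
  shows "t (x [^] (k::int)) = t x powi k"
proof (cases k rule: int_cases2)
  case (nonneg n)
  then show ?thesis by (simp add: int_pow_int torus_nat_pow[OF assms])
next
  case (nonpos n)
  have "t (inv (x [^] n)) = inverse (t x ^ n)"
    using torus_inv[OF assms(1), of "x [^] n"] assms(2) torus_nat_pow[OF assms, of n] by simp
  then show ?thesis
    using nonpos assms(2) by (simp add: int_pow_neg int_pow_int power_int_minus)
qed

lemma continuous_map_torus_top_iff:
  "continuous_map X (torus_top G) f \<longleftrightarrow>
     (\<forall>x\<in>topspace X. f x \<in> carrier (torus G)) \<and> (\<forall>\<gamma>\<in>carrier G. continuous_map X euclidean (\<lambda>x. f x \<gamma>))"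
  unfolding torus_top_def continuous_map_in_subtopology continuous_map_componentwise
  by (auto simp: Pi_iff carrier_torus_iff)

lemma continuous_map_torus_eval:
  "\<gamma> \<in> carrier G \<Longrightarrow> continuous_map (torus_top G) euclidean (\<lambda>t. t \<gamma>)"
  using continuous_map_torus_top_iff[of "torus_top G" G "\<lambda>t. t"] by simp

lemma hom_integer_group_iff:
  "\<phi> \<in> hom G integer_group \<longleftrightarrow> (\<forall>x\<in>carrier G. \<forall>y\<in>carrier G. \<phi> (x \<otimes>\<^bsub>G\<^esub> y) = \<phi> x + \<phi> y)"
  by (auto simp: hom_def)

section \<open>Integer coordinates, primitive elements and their fibres\<close>

locale free_abelian_coordinates = comm_group G for G (structure) +
  fixes d :: nat and \<Phi> :: "'a \<Rightarrow> nat \<Rightarrow>\<^sub>0 int"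
  assumes iso: "\<Phi> \<in> iso G (free_Abelian_group {..<d})"
begin

definition \<Psi> :: "(nat \<Rightarrow>\<^sub>0 int) \<Rightarrow> 'a" where "\<Psi> = inv_into (carrier G) \<Phi>"

lemma coordinate_hom: "(\<lambda>x. Poly_Mapping.lookup (\<Phi> x) i) \<in> hom G integer_group"
  using iso by (auto simp: iso_def hom_def lookup_add)

lemma
  assumes "Poly_Mapping.keys c \<subseteq> {..<d}"
  shows \<Psi>_closed: "\<Psi> c \<in> carrier G" and \<Phi>_\<Psi>: "\<Phi> (\<Psi> c) = c"
proof -
  have "\<Phi> ` carrier G = {c. Poly_Mapping.keys c \<subseteq> {..<d}}"
    using iso by (auto simp: iso_def bij_betw_def carrier_free_Abelian_group_iff)
  then show "\<Psi> c \<in> carrier G" "\<Phi> (\<Psi> c) = c"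
    unfolding \<Psi>_def using assms by (auto intro: inv_into_into f_inv_into_f)
qed

lemma \<Phi>_keys: "x \<in> carrier G \<Longrightarrow> Poly_Mapping.keys (\<Phi> x) \<subseteq> {..<d}"
  using iso by (auto simp: iso_def hom_def Pi_iff carrier_free_Abelian_group_iff)

lemma \<Phi>_inj: "\<lbrakk>x \<in> carrier G; y \<in> carrier G; \<Phi> x = \<Phi> y\<rbrakk> \<Longrightarrow> x = y"
  using iso by (auto simp: iso_def bij_betw_def inj_on_def)

lemma \<Psi>_\<Phi>: "x \<in> carrier G \<Longrightarrow> \<Psi> (\<Phi> x) = x"
  using \<Phi>_inj[OF \<Psi>_closed[OF \<Phi>_keys] _ \<Phi>_\<Psi>[OF \<Phi>_keys]] by simp

lemma \<Phi>_mult: "\<lbrakk>x \<in> carrier G; y \<in> carrier G\<rbrakk> \<Longrightarrow> \<Phi> (x \<otimes> y) = \<Phi> x + \<Phi> y"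
  using iso by (auto simp: iso_def hom_def)

lemma \<Psi>_add:
  assumes "Poly_Mapping.keys a \<subseteq> {..<d}" "Poly_Mapping.keys b \<subseteq> {..<d}"
  shows "\<Psi> (a + b) = \<Psi> a \<otimes> \<Psi> b"
  using \<Psi>_\<Phi>[of "\<Psi> a \<otimes> \<Psi> b"] by (simp add: assms \<Psi>_closed \<Phi>_mult \<Phi>_\<Psi>)

text \<open>Logarithms are chosen for the values of \<open>t\<close> on the basis and extended
  additively; freeness leaves no relation to satisfy, and \<open>exp\<close> turns the sums back
  into products.\<close>

lemma torus_exp_lift:
  assumes t: "t \<in> carrier (torus G)"
  obtains u where "\<And>x. x \<in> carrier G \<Longrightarrow> t x = exp (u x)"
    and "\<And>x y. \<lbrakk>x \<in> carrier G; y \<in> carrier G\<rbrakk> \<Longrightarrow> u (x \<otimes> y) = u x + u y"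
proof -
  define v where "v i = Ln (t (\<Psi> (frag_of i)))" for i
  define U where "U c = (\<Sum>i<d. of_int (Poly_Mapping.lookup c i) * v i)" for c :: "nat \<Rightarrow>\<^sub>0 int"
  have U_add: "U (a + b) = U a + U b" for a b
    by (simp add: U_def lookup_add algebra_simps sum.distrib)
  \<comment> \<open>The support condition is carried through the induction because the difference
    step needs it for both \<open>a\<close> and \<open>b\<close> before \<open>\<Psi>_add\<close>
    applies.\<close>
  have "Poly_Mapping.keys c \<subseteq> {..<d} \<and> t (\<Psi> c) = exp (U c)" if "Poly_Mapping.keys c \<subseteq> {..<d}" for c
    using that
  proof (induction c rule: frag_induction)
    case zero
    have "\<Psi> 0 \<otimes> \<Psi> 0 = \<Psi> 0" using \<Psi>_add[of 0 0] by simp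
    then have "\<Psi> 0 = \<one>" using \<Psi>_closed[of 0] by (simp add: l_cancel_one)
    then show ?case using t by (simp add: U_def torus_one)
  next
    case (one i)
    then have "Poly_Mapping.keys (frag_of i) \<subseteq> {..<d}" by simp
    moreover have "U (frag_of i) = v i"
      using one unfolding U_def by (subst sum.remove[of _ i]) (auto simp: lookup_single)
    ultimately show ?case
      using torus_nonzero[OF t \<Psi>_closed] by (simp add: v_def)
  next
    case (diff a b)
    have keys: "Poly_Mapping.keys (a - b) \<subseteq> {..<d}"
      using diff keys_diff[of a b] by blast
    have "t (\<Psi> (a - b)) * t (\<Psi> b) = t (\<Psi> a)"
      using \<Psi>_add[OF keys, of b] diff keys torus_mult[OF t] \<Psi>_closed by simp
    moreover have "U (a - b) + U b = U a"
      using U_add[of "a - b" b] by simp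
    ultimately have "t (\<Psi> (a - b)) * exp (U b) = exp (U (a - b)) * exp (U b)"
      using diff by (simp flip: exp_add)
    then show ?case using keys by simp
  qed
  then have "t x = exp (U (\<Phi> x))" if "x \<in> carrier G" for x
    using \<Phi>_keys[OF that] \<Psi>_\<Phi>[OF that] by metis
  then show thesis
    by (intro that[of "\<lambda>x. U (\<Phi> x)"]) (simp_all add: \<Phi>_mult U_add)
qed

text \<open>
  \<open>g\<close> is the least positive value at \<open>\<gamma>\<close> of a homomorphism to the integers, hence divides all
  coordinates of \<open>\<gamma>\<close>.
\<close>

lemma primitive_root:
  assumes \<gamma>: "\<gamma> \<in> carrier G" "\<gamma> \<noteq> \<one>"
  obtains \<eta> g \<phi> where "\<eta> \<in> carrier G" "0 < (g::nat)" "\<eta> [^] g = \<gamma>"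
    "\<phi> \<in> hom G integer_group" "\<phi> \<eta> = 1"
proof -
  let ?x = "\<lambda>i y. Poly_Mapping.lookup (\<Phi> y) i"
  define P where "P n \<longleftrightarrow> 0 < n \<and> (\<exists>\<phi>\<in>hom G integer_group. \<phi> \<gamma> = int n)" for n
  have "\<exists>i. ?x i \<gamma> \<noteq> 0"
  proof (rule ccontr)
    assume "\<not> ?thesis"
    then have "\<Phi> \<gamma> = \<Phi> \<one>"
      using \<Phi>_mult[of \<one> \<one>] by (auto intro: poly_mapping_eqI)
    then show False using \<gamma> \<Phi>_inj by blast
  qed
  then obtain i where i: "?x i \<gamma> \<noteq> 0" ..
  have "P (nat \<bar>?x i \<gamma>\<bar>)"
  proof (cases "?x i \<gamma> > 0")
    case True
    then show ?thesis unfolding P_def using coordinate_hom[of i] by auto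
  next
    case False
    then have "- ?x i \<gamma> = int (nat \<bar>?x i \<gamma>\<bar>)" "0 < nat \<bar>?x i \<gamma>\<bar>"
      using i by simp_all
    moreover have "(\<lambda>y. - ?x i y) \<in> hom G integer_group"
      using coordinate_hom[of i] by (auto simp: hom_integer_group_iff)
    ultimately show ?thesis
      unfolding P_def by (intro conjI bexI[of _ "\<lambda>y. - ?x i y"])
  qed
  then obtain g where g: "P g" and least: "\<And>n. P n \<Longrightarrow> g \<le> n"
    by (metis LeastI_ex Least_le)
  then obtain \<phi> where \<phi>: "\<phi> \<in> hom G integer_group" "\<phi> \<gamma> = int g" and g0: "0 < g"
    by (auto simp: P_def)
  have div: "int g * (?x i \<gamma> div int g) = ?x i \<gamma>" for i
  proof -
    \<comment> \<open>Subtracting this multiple of \<open>\<phi>\<close> leaves the remainder modulo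
      \<open>g\<close> as the value at \<open>\<gamma>\<close>; a positive remainder would
      contradict the minimality of \<open>g\<close>.\<close>
    let ?\<psi> = "\<lambda>y. ?x i y - (?x i \<gamma> div int g) * \<phi> y"
    have "?\<psi> \<in> hom G integer_group"
      using \<phi>(1) coordinate_hom[of i] by (simp add: hom_integer_group_iff algebra_simps)
    moreover have "?\<psi> \<gamma> = ?x i \<gamma> mod int g"
      by (simp add: \<phi>(2) minus_div_mult_eq_mod)
    moreover have "0 \<le> ?x i \<gamma> mod int g" "?x i \<gamma> mod int g < int g" using g0 by simp_all
    ultimately have "?x i \<gamma> mod int g = 0"
      using least[of "nat (?x i \<gamma> mod int g)"] unfolding P_def
      by (smt (verit) int_nat_eq nat_less_iff of_nat_0_less_iff not_le)
    then show ?thesis by (simp add: minus_mod_eq_mult_div [symmetric])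
  qed
  define c where "c = Poly_Mapping.map (\<lambda>k. k div int g) (\<Phi> \<gamma>)"
  have c: "Poly_Mapping.lookup c i = ?x i \<gamma> div int g" for i
    by (simp add: c_def map.rep_eq when_def)
  have keys: "Poly_Mapping.keys c \<subseteq> {..<d}"
  proof
    fix i assume "i \<in> Poly_Mapping.keys c"
    then have "?x i \<gamma> \<noteq> 0" by (auto simp: in_keys_iff c)
    then show "i \<in> {..<d}" using \<Phi>_keys[OF \<gamma>(1)] by (auto simp: in_keys_iff)
  qed
  have pow: "\<psi> (y [^] n) = int n * \<psi> y" if "\<psi> \<in> hom G integer_group" "y \<in> carrier G" for \<psi> y and n :: nat
    using hom_nat_pow[OF that is_group group_integer_group] by simp
  have "\<Phi> (\<Psi> c [^] g) = \<Phi> \<gamma>"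
  proof (rule poly_mapping_eqI)
    fix i show "?x i (\<Psi> c [^] g) = ?x i \<gamma>"
      using pow[OF coordinate_hom[of i] \<Psi>_closed[OF keys], of g] div[of i] by (simp add: \<Phi>_\<Psi>[OF keys] c)
  qed
  then have root: "\<Psi> c [^] g = \<gamma>"
    using \<Phi>_inj \<gamma> \<Psi>_closed[OF keys] by simp
  moreover have "\<phi> (\<Psi> c) = 1"
    using pow[OF \<phi>(1) \<Psi>_closed[OF keys], of g] root \<phi>(2) g0 by simp
  ultimately show thesis
    using that \<Psi>_closed[OF keys] g0 \<phi>(1) by blast
qed

text \<open>
  The quotient of two points of the fibre lifts through \<open>exp\<close> to an additive \<open>u\<close>. Since \<open>u \<eta>\<close> is a
  period of \<open>exp\<close>, replacing \<open>u\<close> by \<open>u - \<phi> * u \<eta>\<close> keeps the lift and makes it vanish at \<open>\<eta>\<close>, so the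
  path \<open>exp (\<tau> * u)\<close> stays in the fibre.
\<close>

lemma connectedin_torus_fibre:
  assumes \<eta>: "\<eta> \<in> carrier G" and \<phi>: "\<phi> \<in> hom G integer_group" "\<phi> \<eta> = 1"
  shows "connectedin (torus_top G) {t \<in> carrier (torus G). t \<eta> = \<zeta>}"
proof (rule path_connectedin_imp_connectedin, unfold path_connectedin, intro conjI ballI)
  fix s t assume "s \<in> {t \<in> carrier (torus G). t \<eta> = \<zeta>}" "t \<in> {t \<in> carrier (torus G). t \<eta> = \<zeta>}"
  then have s: "s \<in> carrier (torus G)" "s \<eta> = \<zeta>" and t: "t \<in> carrier (torus G)" "t \<eta> = \<zeta>" by auto
  have "(\<lambda>x\<in>carrier G. t x / s x) \<in> carrier (torus G)"
    using s t by (auto simp: carrier_torus_iff)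
  then obtain u where u: "\<And>x. x \<in> carrier G \<Longrightarrow> (\<lambda>x\<in>carrier G. t x / s x) x = exp (u x)"
    and u_add: "\<And>x y. \<lbrakk>x \<in> carrier G; y \<in> carrier G\<rbrakk> \<Longrightarrow> u (x \<otimes> y) = u x + u y"
    using torus_exp_lift by blast
  have quot: "t x / s x = exp (u x)" if "x \<in> carrier G" for x
    using u[OF that] that by simp
  define u' where "u' x = u x - of_int (\<phi> x) * u \<eta>" for x
  have "exp (u \<eta>) = 1"
    using quot[OF \<eta>] s t torus_nonzero[OF s(1) \<eta>] by simp
  then have "exp (of_int k * u \<eta>) = 1" for k :: int
    by (metis exp_power_int power_int_1_left)
  then have exp_u': "exp (u' x) = t x / s x" if "x \<in> carrier G" for x
    using quot[OF that] by (simp add: u'_def exp_diff)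
  have u'_add: "u' (x \<otimes> y) = u' x + u' y" if "x \<in> carrier G" "y \<in> carrier G" for x y
    using that \<phi>(1) u_add by (simp add: u'_def hom_integer_group_iff algebra_simps)
  have u'_\<eta>: "u' \<eta> = 0" by (simp add: u'_def \<phi>(2))
  define g where "g \<tau> = (\<lambda>x\<in>carrier G. s x * exp (of_real \<tau> * u' x))" for \<tau> :: real
  have g: "g \<tau> \<in> carrier (torus G)" "g \<tau> \<eta> = \<zeta>" for \<tau>
    using s \<eta> u'_\<eta> by (auto simp: g_def carrier_torus_iff u'_add exp_add algebra_simps)
  have "pathin (torus_top G) g"
    unfolding pathin_def continuous_map_torus_top_iff
  proof (intro conjI ballI)
    fix x assume "x \<in> carrier G"
    then have "(\<lambda>\<tau>. g \<tau> x) = (\<lambda>\<tau>. s x * exp (of_real \<tau> * u' x))" by (simp add: g_def)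
    then show "continuous_map (top_of_set {0..1}) euclidean (\<lambda>\<tau>. g \<tau> x)"
      by (auto intro!: continuous_intros)
  qed (use g in auto)
  moreover have "g 0 = s"
    by (rule torus_eqI[OF g(1) s(1)]) (simp add: g_def)
  moreover have "g 1 = t"
    by (rule torus_eqI[OF g(1) t(1)]) (simp add: g_def exp_u' torus_nonzero[OF s(1)])
  ultimately show "\<exists>g. pathin (torus_top G) g \<and> g \<in> {0..1} \<rightarrow> {t \<in> carrier (torus G). t \<eta> = \<zeta>} \<and> g 0 = s \<and> g 1 = t"
    using g by blast
qed auto

text \<open>With \<open>\<gamma>\<close> written as the power \<open>g\<close> of a primitive
  \<open>\<eta>\<close>, the hypertorus is the union of the fibres of \<open>\<eta>\<close> over the
  solutions of \<open>\<zeta> ^ g = 1\<close>. On a component \<open>\<eta>\<close> has connected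
  finite image, hence a single value; conversely the whole fibre is connected, so maximality of the
  component gives equality.\<close>

lemma components_hypertorus:
  assumes \<gamma>: "\<gamma> \<in> carrier G" "\<gamma> \<noteq> \<one>"
  shows "\<exists>\<eta>\<in>carrier G. \<exists>g>0. \<forall>C\<in>components_in (torus_top G) (hypertorus G \<gamma>).
    \<exists>\<zeta>. \<zeta> ^ g = 1 \<and> C = {t \<in> carrier (torus G). t \<eta> = \<zeta>}"
proof -
  obtain \<eta> g \<phi> where \<eta>: "\<eta> \<in> carrier G" and g: "0 < (g::nat)" "\<eta> [^] g = \<gamma>"
    and \<phi>: "\<phi> \<in> hom G integer_group" "\<phi> \<eta> = 1"
    using primitive_root[OF \<gamma>] by blast
  have root: "t \<gamma> = t \<eta> ^ g" if "t \<in> carrier (torus G)" for t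
    using torus_nat_pow[OF that \<eta>] g(2) by blast
  have "\<exists>\<zeta>. \<zeta> ^ g = 1 \<and> C = {t \<in> carrier (torus G). t \<eta> = \<zeta>}"
    if C: "C \<in> components_in (torus_top G) (hypertorus G \<gamma>)" for C
  proof -
    have conn: "connectedin (torus_top G) C" and sub: "C \<subseteq> hypertorus G \<gamma>" and "C \<noteq> {}"
      using C connectedin_connected_components_of nonempty_connected_components_of
      unfolding components_in_def by (force simp: connectedin_subtopology)+
    then obtain t0 where t0: "t0 \<in> C" by blast
    have one: "t \<eta> ^ g = 1" if "t \<in> C" for t
      using sub that root by (auto simp: hypertorus_def)
    have "connected ((\<lambda>t. t \<eta>) ` C)"
      using connectedin_continuous_map_image[OF continuous_map_torus_eval[OF \<eta>] conn] by simp
    moreover have "finite ((\<lambda>t. t \<eta>) ` C)"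
      using one by (intro finite_subset[OF _ finite_nth_roots[OF g(1), of 1]]) auto
    ultimately obtain y where "(\<lambda>t. t \<eta>) ` C = {y}"
      using t0 connected_finite_iff_sing[of "(\<lambda>t. t \<eta>) ` C"] by auto
    then have const: "t \<eta> = t0 \<eta>" if "t \<in> C" for t
      using imageI[OF that, of "\<lambda>t. t \<eta>"] imageI[OF t0, of "\<lambda>t. t \<eta>"] by simp
    let ?K = "{t \<in> carrier (torus G). t \<eta> = t0 \<eta>}"
    have "?K \<subseteq> hypertorus G \<gamma>"
    proof
      fix t assume "t \<in> ?K"
      then show "t \<in> hypertorus G \<gamma>"
        using root[of t] one[OF t0] by (simp add: hypertorus_def)
    qed
    then have "connectedin (subtopology (torus_top G) (hypertorus G \<gamma>)) ?K"
      using connectedin_torus_fibre[OF \<eta> \<phi>] by (simp add: connectedin_subtopology)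
    moreover have "t0 \<in> ?K" using t0 sub by (auto simp: hypertorus_def)
    ultimately have "?K \<subseteq> C"
      using C t0 connected_components_of_maximal unfolding components_in_def disjnt_def by blast
    moreover have "C \<subseteq> ?K" using const sub by (auto simp: hypertorus_def)
    ultimately show ?thesis using one[OF t0] by blast
  qed
  then show ?thesis using \<eta> g(1) by blast
qed

lemma toric_arrangement_element:
  assumes "H \<in> \<A>" "presents G \<XX> \<A>"
  obtains \<eta> \<zeta> where "\<eta> \<in> carrier G" "\<zeta> \<noteq> 0" "H = {t \<in> carrier (torus G). t \<eta> = \<zeta>}"
proof -
  obtain \<gamma> where \<gamma>: "\<gamma> \<in> carrier G" "\<gamma> \<noteq> \<one>" and H: "H \<in> components_in (torus_top G) (hypertorus G \<gamma>)"
    using assms by (auto simp: presents_def toric_arrangement_of_def)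
  obtain \<eta> g where *: "\<eta> \<in> carrier G" "0 < (g::nat)"
    "\<forall>C\<in>components_in (torus_top G) (hypertorus G \<gamma>).
       \<exists>\<zeta>. \<zeta> ^ g = 1 \<and> C = {t \<in> carrier (torus G). t \<eta> = \<zeta>}"
    using components_hypertorus[OF \<gamma>] by blast
  from bspec[OF *(3) H] obtain \<zeta> where "\<zeta> ^ g = 1" "H = {t \<in> carrier (torus G). t \<eta> = \<zeta>}" by blast
  moreover from this(1) have "\<zeta> \<noteq> 0" using *(2) by (auto simp: zero_power)
  ultimately show thesis using that *(1) by blast
qed

text \<open>Each component is determined by a solution of \<open>\<zeta> ^ g = 1\<close>, so every
  defining character contributes finitely many.\<close>

lemma finite_toric_arrangement:
  assumes "presents G \<XX> \<A>"
  shows "finite \<A>"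
proof -
  have "finite (components_in (torus_top G) (hypertorus G \<gamma>))" if "\<gamma> \<in> \<XX>" for \<gamma>
  proof -
    have "\<gamma> \<in> carrier G" "\<gamma> \<noteq> \<one>" using assms that unfolding presents_def by blast+
    from components_hypertorus[OF this] obtain \<eta> g where g: "0 < (g::nat)"
      "\<forall>C\<in>components_in (torus_top G) (hypertorus G \<gamma>).
         \<exists>\<zeta>. \<zeta> ^ g = 1 \<and> C = {t \<in> carrier (torus G). t \<eta> = \<zeta>}"
      by blast
    have "components_in (torus_top G) (hypertorus G \<gamma>) \<subseteq>
        (\<lambda>\<zeta>. {t \<in> carrier (torus G). t \<eta> = \<zeta>}) ` {\<zeta>. \<zeta> ^ g = 1}"
      using g(2) by blast
    then show ?thesis
      using finite_nth_roots[OF g(1), of 1] by (meson finite_imageI finite_subset)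
  qed
  then show ?thesis
    using assms by (auto simp: presents_def toric_arrangement_of_def)
qed

end

section \<open>Projection along an admissible subgroup\<close>

text \<open>Coordinates for the internal direct sum: \<open>e\<close> generates the infinite cyclic
  summand \<open>K\<close>, \<open>a\<close> is the exponent of \<open>e\<close>, and
  \<open>p\<close> is the component in \<open>N\<close>.\<close>

lemma (in comm_group) split_cyclic_summand:
  assumes sub: "subgroup K G" "subgroup N G" and int: "K \<inter> N = {\<one>}" and sum: "K <#> N = carrier G"
    and free: "free_abelian_of_rank (G\<lparr>carrier := K\<rparr>) 1"
  obtains e a p where "e \<in> carrier G" "a \<in> hom G integer_group" "a e = (1::int)" "p \<in> hom G (G\<lparr>carrier := N\<rparr>)"
    "\<And>x. x \<in> carrier G \<Longrightarrow> e [^] a x \<otimes> p x = x" "\<And>x. x \<in> N \<Longrightarrow> a x = 0"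
proof -
  have "integer_group \<cong> free_Abelian_group {..<1::nat}"
    using isomorphic_group_integer_free_Abelian_group_singleton[of "0::nat"] by (simp add: lessThan_Suc)
  moreover have "free_Abelian_group {..<1::nat} \<cong> G\<lparr>carrier := K\<rparr>"
    using free subgroup.subgroup_is_group[OF sub(1) is_group] group.iso_sym
    unfolding free_abelian_of_rank_def by blast
  ultimately have "integer_group \<cong> G\<lparr>carrier := K\<rparr>"
    by (rule iso_trans)
  then obtain E where E: "E \<in> iso integer_group (G\<lparr>carrier := K\<rparr>)"
    unfolding is_iso_def by blast
  have K: "K \<subseteq> carrier G" and N: "N \<subseteq> carrier G"
    using sub subgroup.subset by blast+
  have bij: "bij_betw E UNIV K" and E_add: "\<And>i j. E (i + j) = E i \<otimes> E j"
    using E by (auto simp: iso_def hom_def)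
  have E_in_K: "E k \<in> K" for k using bij by (auto simp: bij_betw_def)
  have E_in: "E k \<in> carrier G" for k using E_in_K K by blast
  have E_hom: "E \<in> hom integer_group G"
    using E_in E_add by (auto simp: hom_def)
  have E_pow: "E k = E 1 [^] k" for k
    using hom_int_pow[OF E_hom _ group_integer_group is_group, of 1 k] by simp
  have E_0: "E 0 = \<one>"
    using hom_one[OF E_hom group_integer_group is_group] by simp
  have E_cancel: "E k \<otimes> E (- k) = \<one>" for k
    unfolding E_add[symmetric] by (simp add: E_0)
  have E_inv: "inv (E k) = E (- k)" for k
    using E_cancel[of "- k"] E_in by (intro inv_equality) auto
  \<comment> \<open>If two shifts of \<open>x\<close> both land in \<open>N\<close>, their quotient
    \<open>E (k - l)\<close> lies in \<open>K \<inter> N\<close> and hence is trivial.\<close>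
  have unique: "k = l" if "x \<in> carrier G" "x \<otimes> E (- k) \<in> N" "x \<otimes> E (- l) \<in> N" for x k l
  proof -
    have "E (k - l) = E (- l) \<otimes> inv (E (- k))"
      using E_add[of "- l" k] by (simp add: E_inv)
    also have "\<dots> = (x \<otimes> inv x) \<otimes> (E (- l) \<otimes> inv (E (- k)))"
      using that(1) E_in by simp
    also have "\<dots> = (x \<otimes> E (- l)) \<otimes> (inv x \<otimes> inv (E (- k)))"
      using that(1) E_in by (simp only: m_ac m_closed inv_closed)
    also have "\<dots> = (x \<otimes> E (- l)) \<otimes> inv (x \<otimes> E (- k))"
      using that(1) E_in by (simp add: inv_mult)
    also have "\<dots> \<in> N"
      using that sub(2) by (meson subgroup.m_closed subgroup.m_inv_closed)
    finally have "E (k - l) \<in> K \<inter> N" using E_in_K by blast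
    then have "E (k - l) = E 0" using int E_0 by simp
    then have "k - l = 0" using bij by (auto simp: bij_betw_def dest: injD)
    then show ?thesis by simp
  qed
  have exists: "\<exists>k. x \<otimes> E (- k) \<in> N" if x: "x \<in> carrier G" for x
  proof -
    obtain g h where "g \<in> K" "h \<in> N" "x = g \<otimes> h"
      using x unfolding sum[symmetric] set_mult_def by blast
    then obtain k where k: "x = E k \<otimes> h" using bij by (auto simp: bij_betw_def)
    have h: "h \<in> carrier G" using \<open>h \<in> N\<close> N by blast
    have "x \<otimes> E (- k) = h \<otimes> (E k \<otimes> E (- k))"
      using E_in h by (simp add: k m_ac)
    also have "\<dots> = h" using E_cancel h by simp
    finally have "x \<otimes> E (- k) = h" .
    then show ?thesis using \<open>h \<in> N\<close> by blast
  qed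
  define a where "a x = (THE k. x \<otimes> E (- k) \<in> N)" for x
  define p where "p x = x \<otimes> E (- a x)" for x
  have a_eq: "a x = k" if "x \<in> carrier G" "x \<otimes> E (- k) \<in> N" for x k
    unfolding a_def using that unique by blast
  have p_in: "p x \<in> N" if "x \<in> carrier G" for x
    using exists[OF that] a_eq[OF that] unfolding p_def by blast
  have p_mult: "x \<otimes> y \<otimes> E (- (a x + a y)) = p x \<otimes> p y" if "x \<in> carrier G" "y \<in> carrier G" for x y
    using that E_in E_add[of "- a x" "- a y"] by (simp add: p_def m_ac)
  \<comment> \<open>By uniqueness of the exponent it suffices that the shift of the product by
    \<open>E (- (a x + a y))\<close> lands in \<open>N\<close>, where it equals
    \<open>p x \<otimes> p y\<close>.\<close>
  have a_mult: "a (x \<otimes> y) = a x + a y" if "x \<in> carrier G" "y \<in> carrier G" for x y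
  proof (rule a_eq)
    show "x \<otimes> y \<otimes> E (- (a x + a y)) \<in> N"
      unfolding p_mult[OF that] using p_in that sub(2) by (meson subgroup.m_closed)
  qed (use that in simp)
  show thesis
  proof
    show "E 1 \<in> carrier G" by (rule E_in)
    show "a \<in> hom G integer_group" using a_mult by (simp add: hom_integer_group_iff)
    show "a (E 1) = 1"
      using a_eq[of "E 1" 1] E_cancel[of 1] E_in subgroup.one_closed[OF sub(2)] by simp
    show "p \<in> hom G (G\<lparr>carrier := N\<rparr>)"
      using p_in p_mult a_mult by (auto simp: hom_def p_def[of "_ \<otimes> _"])
    show "E 1 [^] a x \<otimes> p x = x" if "x \<in> carrier G" for x
    proof -
      have "E (a x) \<otimes> (x \<otimes> E (- a x)) = x \<otimes> (E (a x) \<otimes> E (- a x))"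
        using that E_in by (simp add: m_lcomm)
      also have "\<dots> = x" using that E_cancel by simp
      finally show ?thesis by (simp add: p_def flip: E_pow)
    qed
    show "a x = 0" if "x \<in> N" for x
      using that N a_eq[of x 0] E_0 by auto
  qed
qed

locale torus_splitting = free_abelian_coordinates G d \<Phi>
  for G :: "('a, 'b) monoid_scheme" (structure) and d :: nat and \<Phi> :: "'a \<Rightarrow> nat \<Rightarrow>\<^sub>0 int" +
  fixes N :: "'a set" and e :: 'a and a :: "'a \<Rightarrow> int" and p :: "'a \<Rightarrow> 'a" and Y :: "('a \<Rightarrow> complex) set"
  assumes N: "subgroup N G" and e: "e \<in> carrier G" and a_hom: "a \<in> hom G integer_group" and a_e: "a e = 1"
    and p_hom: "p \<in> hom G (G\<lparr>carrier := N\<rparr>)"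
    and split: "x \<in> carrier G \<Longrightarrow> e [^] a x \<otimes> p x = x"
    and a_N: "x \<in> N \<Longrightarrow> a x = 0"
    and Y: "Y = {t \<in> carrier (torus G). \<forall>\<gamma>\<in>N. t \<gamma> = 1}"
begin

abbreviation "T \<equiv> carrier (torus G)"
abbreviation "TT \<equiv> torus_top G"
abbreviation "proj \<equiv> torus_proj G Y"
abbreviation "Q \<equiv> torus_quotient_top G Y"

section \<open>Splitting a character into its value at \<open>e\<close> and its restriction to
  \<open>N\<close>\<close>

lemma N_subset: "x \<in> N \<Longrightarrow> x \<in> carrier G"
  using N subgroup.subset by blast

lemma p_in: "x \<in> carrier G \<Longrightarrow> p x \<in> N"
  using p_hom by (auto simp: hom_def)

lemma p_carrier: "x \<in> carrier G \<Longrightarrow> p x \<in> carrier G"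
  using p_in N_subset by blast

lemma p_mult: "\<lbrakk>x \<in> carrier G; y \<in> carrier G\<rbrakk> \<Longrightarrow> p (x \<otimes> y) = p x \<otimes> p y"
  using p_hom by (auto simp: hom_def)

lemma a_mult: "\<lbrakk>x \<in> carrier G; y \<in> carrier G\<rbrakk> \<Longrightarrow> a (x \<otimes> y) = a x + a y"
  using a_hom by (simp add: hom_integer_group_iff)

lemma a_zero: "\<lbrakk>x \<in> carrier G; a x = 0\<rbrakk> \<Longrightarrow> x \<in> N"
  using split[of x] p_in[of x] N_subset[of "p x"] by simp

lemma p_N: "x \<in> N \<Longrightarrow> p x = x"
  using split[of x] a_N[of x] N_subset[of x] p_carrier[of x] by simp

lemma p_e: "p e = \<one>"
  using split[of e] a_e e p_carrier[of e] by (simp add: r_cancel_one')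

lemma eval_split:
  assumes "t \<in> T" "x \<in> carrier G"
  shows "t x = t e powi a x * t (p x)"
proof -
  have "t (e [^] a x \<otimes> p x) = t (e [^] a x) * t (p x)"
    using assms e p_carrier by (intro torus_mult[of t G]) auto
  then show ?thesis
    using split[OF assms(2)] torus_int_pow[OF assms(1) e] by simp
qed

text \<open>Inverse of the coordinates on the torus: for a character \<open>s\<close>, the result
  takes the value \<open>z\<close> at \<open>e\<close> and agrees with \<open>s\<close> on
  \<open>N\<close>. Since \<open>p x\<close> lies in \<open>N\<close>, it depends on
  \<open>s\<close> only through the restriction to \<open>N\<close>, that is, through its
  coset.\<close>

definition build :: "complex \<Rightarrow> ('a \<Rightarrow> complex) \<Rightarrow> 'a \<Rightarrow> complex" where
  "build z s = (\<lambda>x\<in>carrier G. z powi a x * s (p x))"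

lemma build_torus: "\<lbrakk>z \<noteq> 0; s \<in> T\<rbrakk> \<Longrightarrow> build z s \<in> T"
  unfolding carrier_torus_iff[of "build z s" G]
  using p_carrier torus_nonzero[of s G] torus_mult[of s G]
  by (auto simp: build_def a_mult p_mult power_int_add)

lemma build_e: "s \<in> T \<Longrightarrow> build z s e = z"
  using e a_e torus_one[of s] by (simp add: build_def p_e)

lemma build_N: "x \<in> N \<Longrightarrow> build z s x = s x"
  using N_subset by (simp add: build_def a_N p_N)

lemma build_eq:
  assumes "t \<in> T" "s \<in> T" "\<And>x. x \<in> N \<Longrightarrow> s x = t x"
  shows "build (t e) s = t"
proof (rule torus_eqI)
  show "build (t e) s \<in> T"
    using build_torus assms torus_nonzero[OF assms(1) e] by blast
  show "build (t e) s x = t x" if "x \<in> carrier G" for x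
    using eval_split[OF assms(1) that] assms(3)[OF p_in[OF that]] that by (simp add: build_def)
qed fact

text \<open>The pointwise quotient of two characters with the same restriction to \<open>N\<close>
  is trivial on \<open>N\<close>, that is, an element of \<open>Y\<close>.\<close>

lemma proj_eq:
  assumes "t \<in> T"
  shows "proj t = {s \<in> T. \<forall>x\<in>N. s x = t x}"
proof (intro subset_antisym subsetI)
  fix s assume "s \<in> proj t"
  then obtain y where y: "y \<in> Y" "s = y \<otimes>\<^bsub>torus G\<^esub> t" by (auto simp: torus_proj_def r_coset_def)
  then have "s = (\<lambda>x\<in>carrier G. y x * t x)" by (simp add: torus_def)
  then show "s \<in> {s \<in> T. \<forall>x\<in>N. s x = t x}"
    using y(1) assms N_subset unfolding Y by (auto simp: carrier_torus_iff)
next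
  fix s assume s: "s \<in> {s \<in> T. \<forall>x\<in>N. s x = t x}"
  define y where "y = (\<lambda>x\<in>carrier G. s x / t x)"
  have nz: "t x \<noteq> 0" if "x \<in> carrier G" for x using torus_nonzero[OF assms that] .
  have "y \<in> T" using s assms by (auto simp: carrier_torus_iff y_def)
  then have "y \<in> Y"
    using s nz N_subset unfolding Y by (auto simp: y_def)
  moreover have "s = y \<otimes>\<^bsub>torus G\<^esub> t"
  proof -
    have "s \<in> extensional (carrier G)" using s by (simp add: carrier_torus_iff)
    then show ?thesis using nz by (auto simp: torus_def y_def extensional_def fun_eq_iff)
  qed
  ultimately show "s \<in> proj t" by (auto simp: torus_proj_def r_coset_def)
qed

lemma proj_eq_iff: "\<lbrakk>s \<in> T; t \<in> T\<rbrakk> \<Longrightarrow> proj s = proj t \<longleftrightarrow> (\<forall>x\<in>N. s x = t x)"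
  using proj_eq[of s] proj_eq[of t] by auto

lemma quotient_map_proj: "quotient_map TT Q proj"
  unfolding torus_quotient_top_def by (rule quotient_map_quotient_topology)

lemma topspace_Q: "topspace Q = proj ` T"
  by (simp add: torus_quotient_top_def)

text \<open>The character \<open>build 1 t\<close> depends only on the restriction of
  \<open>t\<close> to \<open>N\<close>, so it is constant on cosets and descends continuously
  through the quotient map. Functions of a coset can then be written as functions of the character
  \<open>\<sigma> b\<close>.\<close>

lemma section_exists:
  obtains \<sigma> where "continuous_map Q TT \<sigma>" "\<And>t x. \<lbrakk>t \<in> T; x \<in> N\<rbrakk> \<Longrightarrow> \<sigma> (proj t) x = t x"
    "\<And>t. t \<in> T \<Longrightarrow> \<sigma> (proj t) \<in> T"
proof -
  have cont: "continuous_map TT TT (build 1)"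
    unfolding continuous_map_torus_top_iff
  proof (intro conjI ballI)
    fix x assume "x \<in> carrier G"
    then have "continuous_map TT euclidean (\<lambda>t. t (p x))" "(\<lambda>t. build 1 t x) = (\<lambda>t. t (p x))"
      using continuous_map_torus_eval[OF p_carrier] by (simp_all add: build_def)
    then show "continuous_map TT euclidean (\<lambda>t. build 1 t x)" by simp
  qed (use build_torus in auto)
  show thesis
  proof (rule quotient_map_lift_exists[OF quotient_map_proj cont])
    show "build 1 s = build 1 t" if "s \<in> topspace TT" "t \<in> topspace TT" "proj s = proj t" for s t
      using that proj_eq_iff p_in by (auto simp: build_def intro!: restrict_ext)
  next
    fix \<sigma> assume "continuous_map Q TT \<sigma>" and \<sigma>: "\<And>t. t \<in> topspace TT \<Longrightarrow> \<sigma> (proj t) = build 1 t"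
    then show thesis
    proof (intro that)
      show "\<sigma> (proj t) x = t x" if "t \<in> T" "x \<in> N" for t x
        using \<sigma>[of t] build_N[OF that(2)] that(1) by simp
      show "\<sigma> (proj t) \<in> T" if "t \<in> T" for t
        using \<sigma>[of t] build_torus[OF _ that, of 1] that by simp
    qed
  qed
qed

text \<open>Invariance under every change of a character that fixes its restriction to
  \<open>N\<close> makes \<open>H\<close> the union of the cosets of its points.\<close>

lemma sub_arrangementI:
  assumes "H \<in> \<A>" "H \<subseteq> T" "\<And>s t. \<lbrakk>s \<in> T; t \<in> H; \<And>x. x \<in> N \<Longrightarrow> s x = t x\<rbrakk> \<Longrightarrow> s \<in> H"
  shows "H \<in> sub_arrangement G Y \<A>"
proof -
  have "H = \<Union>(proj ` H)"
  proof (intro subset_antisym subsetI)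
    fix s assume "s \<in> H"
    then show "s \<in> \<Union>(proj ` H)" using proj_eq[of s] assms(2) by auto
  next
    fix s assume "s \<in> \<Union>(proj ` H)"
    then obtain t where t: "t \<in> H" "s \<in> proj t" by blast
    then show "s \<in> H" using proj_eq[of t] assms(2,3) by auto
  qed
  moreover have "proj ` H \<subseteq> rcosets\<^bsub>torus G\<^esub> Y"
    using assms(2) by (auto simp: RCOSETS_def torus_proj_def)
  ultimately show ?thesis
    using assms(1) unfolding sub_arrangement_def by blast
qed

text \<open>A union of cosets contains the whole coset of each of its points, so membership can be
  tested after projection.\<close>

lemma sub_arrangementD:
  assumes "H \<in> sub_arrangement G Y \<A>" "t \<in> T" "proj t \<in> proj ` H"
  shows "t \<in> H"
proof -
  obtain \<C> where \<C>: "\<C> \<subseteq> rcosets\<^bsub>torus G\<^esub> Y" "H = \<Union>\<C>"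
    using assms(1) by (auto simp: sub_arrangement_def)
  obtain s where s: "s \<in> H" "proj t = proj s" using assms(3) by blast
  then obtain X where X: "X \<in> \<C>" "s \<in> X" using \<C>(2) by blast
  then obtain r where "r \<in> T" "X = proj r"
    using \<C>(1) by (auto simp: RCOSETS_def torus_proj_def)
  then have r: "r \<in> T" "s \<in> proj r" "proj r \<subseteq> H"
    using X \<C>(2) by blast+
  then have "s \<in> T" "\<forall>x\<in>N. s x = r x" using proj_eq by auto
  then have "t \<in> proj r"
    using s(2) proj_eq_iff[OF assms(2)] proj_eq[OF r(1)] assms(2) by simp
  then show ?thesis using r(3) by blast
qed

text \<open>On the fibre \<open>t \<eta> = \<zeta>\<close> the splitting gives
  \<open>t e powi a \<eta> * t (p \<eta>) = \<zeta>\<close>. If \<open>a \<eta>\<close> were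
  \<open>0\<close>, then \<open>\<eta>\<close> would lie in \<open>N\<close> and \<open>H\<close>
  would be a union of cosets; otherwise the equation can be solved for a positive power of
  \<open>t e\<close>.\<close>

lemma hypersurface_equation:
  assumes \<A>: "presents G \<XX> \<A>" and H: "H \<in> \<A> - sub_arrangement G Y \<A>"
  shows "\<exists>m W. 0 < m \<and> H = {t \<in> T. t e ^ m = W t} \<and> (\<forall>t\<in>T. W t \<noteq> 0) \<and>
    continuous_map TT (euclidean :: complex topology) W \<and>
    (\<forall>s\<in>T. \<forall>t\<in>T. (\<forall>x\<in>N. s x = t x) \<longrightarrow> W s = W t)"
proof -
  obtain \<eta> \<zeta> where \<eta>: "\<eta> \<in> carrier G" and \<zeta>: "\<zeta> \<noteq> 0" and H_eq: "H = {t \<in> T. t \<eta> = \<zeta>}"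
    using toric_arrangement_element[OF _ \<A>, of H] H by blast
  have nz: "a \<eta> \<noteq> 0"
  proof
    assume "a \<eta> = 0"
    then have "\<eta> \<in> N" using a_zero \<eta> by blast
    then have "H \<in> sub_arrangement G Y \<A>"
      using H by (intro sub_arrangementI) (auto simp: H_eq)
    then show False using H by blast
  qed
  define m where "m = nat \<bar>a \<eta>\<bar>"
  \<comment> \<open>The sign of \<open>a \<eta>\<close> decides which side is inverted to make the
    exponent positive. Only \<open>t (p \<eta>)\<close> enters, so \<open>W\<close> is constant on
    cosets of \<open>Y\<close>.\<close>
  define W where "W t = (if 0 < a \<eta> then \<zeta> / t (p \<eta>) else t (p \<eta>) / \<zeta>)" for t :: "'a \<Rightarrow> complex"
  have pnz: "t (p \<eta>) \<noteq> 0" if "t \<in> T" for t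
    using torus_nonzero[OF that p_carrier[OF \<eta>]] .
  have "t \<eta> = \<zeta> \<longleftrightarrow> t e ^ m = W t" if "t \<in> T" for t
  proof (cases "0 < a \<eta>")
    case True
    then have "t e powi a \<eta> = t e ^ m" by (simp add: m_def power_int_def)
    then show ?thesis
      using eval_split[OF that \<eta>] pnz[OF that] True by (simp add: W_def eq_divide_eq)
  next
    case False
    then have "t e powi a \<eta> = inverse (t e ^ m)" by (simp add: m_def power_int_def power_inverse nz)
    then have "t \<eta> = \<zeta> \<longleftrightarrow> t (p \<eta>) / t e ^ m = \<zeta>"
      using eval_split[OF that \<eta>] by (simp add: divide_inverse mult.commute)
    also have "\<dots> \<longleftrightarrow> t e ^ m = t (p \<eta>) / \<zeta>"
      using torus_nonzero[OF that e] \<zeta> by (auto simp: divide_eq_eq eq_divide_eq mult.commute)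
    finally show ?thesis using False by (simp add: W_def)
  qed
  then have "H = {t \<in> T. t e ^ m = W t}" by (auto simp: H_eq)
  moreover have "continuous_map TT euclidean W"
  proof -
    define h where "h u = (if 0 < a \<eta> then \<zeta> / u else u / \<zeta>)" for u
    have "continuous_on (- {0}) h"
      unfolding h_def by (cases "0 < a \<eta>") (auto intro!: continuous_intros simp: \<zeta>)
    then have "continuous_map (top_of_set (- {0})) euclidean h" by simp
    moreover have "continuous_map TT (top_of_set (- {0})) (\<lambda>t. t (p \<eta>))"
      unfolding continuous_map_in_subtopology
      using continuous_map_torus_eval[OF p_carrier[OF \<eta>]] pnz by auto
    ultimately have "continuous_map TT euclidean (h \<circ> (\<lambda>t. t (p \<eta>)))"
      using continuous_map_compose by blast
    moreover have "h \<circ> (\<lambda>t. t (p \<eta>)) = W" by (auto simp: h_def W_def fun_eq_iff)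
    ultimately show ?thesis by simp
  qed
  moreover have "0 < m" using nz by (simp add: m_def)
  moreover have "\<forall>t\<in>T. W t \<noteq> 0" using pnz \<zeta> by (simp add: W_def)
  moreover have "\<forall>s\<in>T. \<forall>t\<in>T. (\<forall>x\<in>N. s x = t x) \<longrightarrow> W s = W t"
    using p_in[OF \<eta>] by (simp add: W_def)
  ultimately show ?thesis by blast
qed


lemma fibre_bundle_pullbacks:
  assumes \<A>: "presents G \<XX> \<A>" and M: "M_ideal G Y \<A>"
  shows "\<exists>n>0.
    (\<exists>f. is_pullback_along (complement_top TT \<A>)
       (complement_top Q (quotient_arrangement G Y \<A>)) proj
       (Conf_comp [n, 1] (euclidean :: complex topology)) (Conf_comp [n] euclidean) butlast f) \<and>
    (TM_ideal G Y \<A> \<longrightarrow> (\<exists>f. is_pullback_along (complement_top TT \<A>)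
       (complement_top Q (quotient_arrangement G Y \<A>)) proj
       (Conf (n + 1) (euclidean :: complex topology)) (Conf n euclidean) (\<lambda>x. restrict x {..<n}) f))"
proof -

  \<comment> \<open>Equations of the members outside the subarrangement, read on the coset
    space\<close>
  define I where "I = \<A> - sub_arrangement G Y \<A>"
  obtain m W where mW: "\<And>H. H \<in> I \<Longrightarrow> 0 < m H" "\<And>H. H \<in> I \<Longrightarrow> H = {t \<in> T. t e ^ m H = W H t}"
    "\<And>H t. H \<in> I \<Longrightarrow> t \<in> T \<Longrightarrow> W H t \<noteq> 0"
    "\<And>H. H \<in> I \<Longrightarrow> continuous_map TT (euclidean :: complex topology) (W H)"
    "\<And>H s t. \<lbrakk>H \<in> I; s \<in> T; t \<in> T; \<And>x. x \<in> N \<Longrightarrow> s x = t x\<rbrakk> \<Longrightarrow> W H s = W H t"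
  proof -
    let ?R = "\<lambda>H m W. 0 < m \<and> H = {t \<in> T. t e ^ m = W t} \<and> (\<forall>t\<in>T. W t \<noteq> 0) \<and>
      continuous_map TT (euclidean :: complex topology) W \<and>
      (\<forall>s\<in>T. \<forall>t\<in>T. (\<forall>x\<in>N. s x = t x) \<longrightarrow> W s = W t)"
    have "\<forall>H\<in>I. \<exists>mW. ?R H (fst mW) (snd mW)"
      using hypersurface_equation[OF \<A>] unfolding I_def by simp
    from bchoice[OF this] obtain F where F: "\<forall>H\<in>I. ?R H (fst (F H)) (snd (F H))" ..
    show thesis
    proof (rule that[of "\<lambda>H. fst (F H)" "\<lambda>H. snd (F H)"])
      fix H assume "H \<in> I"
      from bspec[OF F this] show "H = {t \<in> T. t e ^ fst (F H) = snd (F H) t}" by blast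
    qed (use F in blast)+
  qed
  obtain \<sigma> where \<sigma>: "continuous_map Q TT \<sigma>" "\<And>t x. \<lbrakk>t \<in> T; x \<in> N\<rbrakk> \<Longrightarrow> \<sigma> (proj t) x = t x"
    "\<And>t. t \<in> T \<Longrightarrow> \<sigma> (proj t) \<in> T"
    using section_exists by blast
  define E where "E = complement_top TT \<A>"
  define B where "B = complement_top Q (quotient_arrangement G Y \<A>)"
  \<comment> \<open>\<open>W H\<close> is constant on cosets, so evaluating it on the section gives
    its value on the coset \<open>b\<close> and shows continuity in \<open>b\<close>.\<close>
  define w where "w H b = W H (\<sigma> b)" for H b
  have top_E: "topspace E = T - \<Union>\<A>"
    by (auto simp: E_def complement_top_def)
  have top_B: "topspace B = proj ` T - (\<Union>H\<in>sub_arrangement G Y \<A>. proj ` H)"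
    by (auto simp: B_def complement_top_def quotient_arrangement_def topspace_Q)
  have B_cases: "\<exists>t\<in>T. b = proj t" if "b \<in> topspace B" for b using that top_B by blast
  have \<sigma>_in: "\<sigma> b \<in> T" if "b \<in> topspace B" for b using B_cases[OF that] \<sigma>(3) by blast
  have build_in: "build z (\<sigma> b) \<in> T" if "b \<in> topspace B" "z \<noteq> 0" for b z
    using build_torus \<sigma>_in that by blast
  have proj_build: "proj (build z (\<sigma> b)) = b" if b: "b \<in> topspace B" and "z \<noteq> 0" for b z
  proof -
    obtain t where t: "t \<in> T" "b = proj t" using B_cases[OF b] by blast
    have "proj (build z (\<sigma> b)) = proj t"
      using proj_eq_iff[OF build_in[OF that] t(1)] build_N \<sigma>(2) t by simp
    then show ?thesis using t by simp
  qed
  have build_not_sub: "build z (\<sigma> b) \<notin> H"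
    if "b \<in> topspace B" "z \<noteq> 0" "H \<in> sub_arrangement G Y \<A>" for b z H
    using proj_build[OF that(1,2)] that(1,3) top_B by blast
  have W_build: "W H (build z (\<sigma> b)) = w H b" if "b \<in> topspace B" "z \<noteq> 0" "H \<in> I" for H b z
    unfolding w_def by (rule mW(5)[OF that(3) build_in[OF that(1,2)] \<sigma>_in[OF that(1)] build_N])
  have build_in_H: "build z (\<sigma> b) \<in> H \<longleftrightarrow> z ^ m H = w H b" if "b \<in> topspace B" "z \<noteq> 0" "H \<in> I" for H b z
  proof -
    have "build z (\<sigma> b) \<in> H \<longleftrightarrow> build z (\<sigma> b) e ^ m H = W H (build z (\<sigma> b))"
      using build_in[OF that(1,2)] mW(2)[OF that(3)] by blast
    then show ?thesis using W_build[OF that] build_e[OF \<sigma>_in[OF that(1)]] by simp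
  qed

  \<comment> \<open>Separation of the roots\<close>
  have sep: "separated_roots B I m w"
    unfolding separated_roots_def
  proof (intro conjI ballI allI impI)
    show "finite I" using finite_toric_arrangement[OF \<A>] by (simp add: I_def)
  next
    fix H assume H: "H \<in> I"
    show "0 < m H" by (rule mW(1)[OF H])
    have "continuous_map B TT \<sigma>"
      unfolding B_def complement_top_def by (rule continuous_map_from_subtopology[OF \<sigma>(1)])
    from continuous_map_compose[OF this mW(4)[OF H]]
    show "continuous_map B euclidean (w H)" by (simp add: w_def[abs_def] o_def)
  next
    fix b H assume "b \<in> topspace B" "H \<in> I"
    then show "w H b \<noteq> 0" unfolding w_def by (intro mW(3) \<sigma>_in)
  next
    fix b H H' z assume b: "b \<in> topspace B" and H: "H \<in> I" "H' \<in> I" and z: "z ^ m H = w H b \<and> z ^ m H' = w H' b"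
    show "H = H'"
    proof (rule ccontr)
      assume ne: "H \<noteq> H'"
      have z0: "z \<noteq> 0"
        using z mW(1,3)[OF H(1)] \<sigma>_in[OF b] by (auto simp: w_def zero_power)
      \<comment> \<open>A common root over \<open>b\<close> gives a point of
        \<open>H \<inter> H'\<close> in the coset \<open>b\<close>. The M-ideal condition puts its
        component inside some \<open>H3\<close> of the subarrangement, although \<open>b\<close>
        lies off the image of every such member.\<close>
      let ?x = "build z (\<sigma> b)"
      have "?x \<in> H \<inter> H'" using build_in_H[OF b z0] H z by blast
      moreover have "H \<inter> H' \<subseteq> topspace TT" using mW(2)[OF H(1)] by auto
      ultimately obtain X where X: "X \<in> components_in TT (H \<inter> H')" "?x \<in> X"
        using Union_components_in by blast
      then obtain H3 where "H3 \<in> sub_arrangement G Y \<A>" "X \<subseteq> H3"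
        using M H ne unfolding M_ideal_def I_def by blast
      then show False using X(2) build_not_sub[OF b z0] by blast
    qed
  qed

  \<comment> \<open>The complement in fibre coordinates\<close>
  define S where "S = root_set I m w"
  \<comment> \<open>Members of the subarrangement are saturated for \<open>proj\<close>, so a point
    outside them projects outside their images.\<close>
  have proj_B: "proj t \<in> topspace B" if "t \<in> topspace E" for t
  proof -
    have "t \<notin> H" if "H \<in> sub_arrangement G Y \<A>" for H
      using that \<open>t \<in> topspace E\<close> top_E by (auto simp: sub_arrangement_def)
    then show ?thesis
      using that top_E sub_arrangementD unfolding top_B by blast
  qed
  have homeo: "homeomorphic_map E (subtopology (prod_topology B euclidean) {(b, z). z \<notin> S b}) (\<lambda>t. (proj t, t e))"
    (is "homeomorphic_map E ?D ?f")
  proof -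
    have "homeomorphic_maps E ?D ?f (\<lambda>(b, z). build z (\<sigma> b))"
      unfolding homeomorphic_maps_def
    proof (intro conjI ballI)
      have "continuous_map E Q proj"
        unfolding E_def complement_top_def
        by (rule continuous_map_from_subtopology[OF quotient_imp_continuous_map[OF quotient_map_proj]])
      then have "continuous_map E B proj"
        using proj_B unfolding B_def complement_top_def by (auto simp: continuous_map_in_subtopology)
      moreover have "continuous_map E euclidean (\<lambda>t. t e)"
        unfolding E_def complement_top_def
        by (rule continuous_map_from_subtopology[OF continuous_map_torus_eval[OF e]])
      moreover have "t e \<notin> S (proj t)" if t: "t \<in> topspace E" for t
      proof -
        have tT: "t \<in> T" using t top_E by blast
        have "t e \<noteq> 0" by (rule torus_nonzero[OF tT e])
        moreover have "t e ^ m H \<noteq> w H (proj t)" if H: "H \<in> I" for H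
        proof -
          have "t \<notin> H" using t H top_E by (auto simp: I_def)
          then have "t e ^ m H \<noteq> W H t" using mW(2)[OF H] tT by blast
          moreover have "w H (proj t) = W H t"
            unfolding w_def by (rule mW(5)[OF H \<sigma>(3)[OF tT] tT \<sigma>(2)[OF tT]])
          ultimately show ?thesis by simp
        qed
        ultimately show ?thesis by (auto simp: S_def root_set_def)
      qed
      ultimately show "continuous_map E ?D ?f"
        by (auto simp: continuous_map_in_subtopology continuous_map_pairwise o_def)
    next
      have D: "b \<in> topspace B" "z \<noteq> 0" "\<And>H. H \<in> I \<Longrightarrow> z ^ m H \<noteq> w H b" if "(b, z) \<in> topspace ?D" for b z
        using that by (auto simp: S_def root_set_def)
      have "continuous_map ?D TT (\<lambda>(b, z). build z (\<sigma> b))"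
        unfolding continuous_map_torus_top_iff
      proof (intro conjI ballI)
        fix y assume "y \<in> topspace ?D"
        then show "(case y of (b, z) \<Rightarrow> build z (\<sigma> b)) \<in> T"
          using build_in D by (cases y) auto
      next
        fix x assume x: "x \<in> carrier G"
        have fst: "continuous_map ?D B fst" and snd: "continuous_map ?D euclidean snd"
          by (rule continuous_map_from_subtopology[OF continuous_map_fst] continuous_map_from_subtopology[OF continuous_map_snd])+
        have "continuous_map B TT \<sigma>"
          unfolding B_def complement_top_def by (rule continuous_map_from_subtopology[OF \<sigma>(1)])
        from continuous_map_compose[OF continuous_map_compose[OF fst this] continuous_map_torus_eval[OF p_carrier[OF x]]]
        have c1: "continuous_map ?D euclidean (\<lambda>y. \<sigma> (fst y) (p x))" by (simp add: o_def)
        \<comment> \<open>The exponent \<open>a x\<close> can be negative, so continuity of the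
          power needs \<open>snd\<close> to avoid \<open>0\<close>; it does, since \<open>0\<close>
          belongs to every \<open>S b\<close>.\<close>
        have "continuous_map ?D (top_of_set (- {0})) snd"
          unfolding continuous_map_in_subtopology using snd D(2) by auto
        moreover have "continuous_map (top_of_set (- {0::complex})) euclidean (\<lambda>z. z powi a x)"
          by (auto intro!: continuous_intros)
        ultimately have c2: "continuous_map ?D euclidean ((\<lambda>z. z powi a x) \<circ> snd)"
          using continuous_map_compose by blast
        have "continuous_map ?D (prod_topology euclidean euclidean) (\<lambda>y. (snd y powi a x, \<sigma> (fst y) (p x)))"
          using c1 c2 by (simp only: continuous_map_pairwise o_def fst_conv snd_conv)
        then have "continuous_map ?D (euclidean :: (complex \<times> complex) topology) (\<lambda>y. (snd y powi a x, \<sigma> (fst y) (p x)))"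
          by simp
        moreover have "continuous_map (euclidean :: (complex \<times> complex) topology) euclidean (\<lambda>u. fst u * snd u)"
          by (auto intro!: continuous_intros)
        ultimately have "continuous_map ?D euclidean ((\<lambda>u. fst u * snd u) \<circ> (\<lambda>y. (snd y powi a x, \<sigma> (fst y) (p x))))"
          using continuous_map_compose by blast
        moreover have "(\<lambda>u. fst u * snd u) \<circ> (\<lambda>y. (snd y powi a x, \<sigma> (fst y) (p x))) =
            (\<lambda>y. (case y of (b, z) \<Rightarrow> build z (\<sigma> b)) x)"
          using x by (auto simp: fun_eq_iff build_def)
        ultimately show "continuous_map ?D euclidean (\<lambda>y. (case y of (b, z) \<Rightarrow> build z (\<sigma> b)) x)"
          by simp
      qed
      \<comment> \<open>A member in the subarrangement is excluded because \<open>b\<close> lies off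
        its image, any other member because \<open>z\<close> is not a root of its equation.\<close>
      moreover have "build z (\<sigma> b) \<notin> \<Union>\<A>" if "(b, z) \<in> topspace ?D" for b z
      proof
        assume "build z (\<sigma> b) \<in> \<Union>\<A>"
        then obtain H where "H \<in> \<A>" "build z (\<sigma> b) \<in> H" by blast
        then show False
          using build_not_sub[OF D(1,2)[OF that], of H] build_in_H[OF D(1,2)[OF that], of H] D(3)[OF that, of H]
          unfolding I_def by blast
      qed
      moreover have "build z (\<sigma> b) \<in> T" if "(b, z) \<in> topspace ?D" for b z
        using build_in D[OF that] by blast
      ultimately show "continuous_map ?D E (\<lambda>(b, z). build z (\<sigma> b))"
        unfolding E_def complement_top_def continuous_map_in_subtopology by auto
      fix y assume "y \<in> topspace ?D"
      then show "?f (case y of (b, z) \<Rightarrow> build z (\<sigma> b)) = y"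
        using D proj_build build_e \<sigma>_in by (cases y) auto
    next
      fix t assume "t \<in> topspace E"
      then have "t \<in> T" using top_E by blast
      then show "(case ?f t of (b, z) \<Rightarrow> build z (\<sigma> b)) = t"
        using build_eq[of t "\<sigma> (proj t)"] \<sigma>(2,3) by simp
    qed
    then show ?thesis unfolding homeomorphic_map_maps by blast
  qed

  \<comment> \<open>Classifying maps to the configuration spaces\<close>
  define n where "n = Suc (\<Sum>H\<in>I. m H)"
  have local: "\<exists>U s. openin B U \<and> b \<in> U \<and> continuous_map (subtopology B U) (Conf n euclidean) s \<and>
      (\<forall>b'\<in>U. s b' ` {..<n} = S b')" if "b \<in> topspace B" for b
    unfolding S_def by (rule root_set_local_ordering[OF sep that n_def])
  have "is_pullback_along E B proj (Conf_comp [n, 1] euclidean) (Conf_comp [n] euclidean) butlast (\<lambda>b. [S b])"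
    by (rule pullback_Conf_comp[OF local homeo])
  moreover have "\<exists>f. is_pullback_along E B proj (Conf (n + 1) (euclidean :: complex topology)) (Conf n euclidean)
      (\<lambda>x. restrict x {..<n}) f" if TM: "TM_ideal G Y \<A>"
  proof -
    have one: "m H = 1" if H: "H \<in> I" for H
    proof -
      \<comment> \<open>The identity of the torus. Every element of \<open>Y\<close> agrees with
        \<open>u\<close> on \<open>N\<close>, so evaluation at \<open>e\<close> maps
        \<open>H \<inter> Y\<close> onto the \<open>m H\<close> solutions of
        \<open>z ^ m H = W H u\<close>; connectedness of this finite nonempty set leaves only
        one.\<close>
      define u where "u = (\<lambda>x\<in>carrier G. 1 :: complex)"
      have u: "u \<in> T" by (auto simp: u_def carrier_torus_iff)
      have "(\<lambda>t. t e) ` (H \<inter> Y) = {z. z ^ m H = W H u}"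
      proof (intro subset_antisym subsetI)
        fix z assume "z \<in> (\<lambda>t. t e) ` (H \<inter> Y)"
        then obtain t where t: "t \<in> H" "t \<in> Y" "z = t e" by blast
        have tT: "t \<in> T" using t(2) Y by blast
        have "W H t = W H u"
          using t(2) N_subset by (intro mW(5)[OF H tT u]) (auto simp: Y u_def)
        moreover have "t e ^ m H = W H t" using t(1) mW(2)[OF H] by blast
        ultimately show "z \<in> {z. z ^ m H = W H u}" using t(3) by simp
      next
        fix z assume "z \<in> {z. z ^ m H = W H u}"
        then have z: "z ^ m H = W H u" by simp
        then have z0: "z \<noteq> 0" using mW(1)[OF H] mW(3)[OF H u] by (auto simp: zero_power)
        have bT: "build z u \<in> T" by (rule build_torus[OF z0 u])
        have "W H (build z u) = W H u"
          by (rule mW(5)[OF H bT u build_N])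
        then have "build z u \<in> H" using mW(2)[OF H] bT z build_e[OF u] by auto
        moreover have "build z u \<in> Y"
          using bT build_N N_subset by (auto simp: Y u_def)
        ultimately show "z \<in> (\<lambda>t. t e) ` (H \<inter> Y)"
          using build_e[OF u, of z] by (metis IntI image_eqI)
      qed
      moreover have "connected ((\<lambda>t. t e) ` (H \<inter> Y))"
      proof -
        have "connectedin TT (H \<inter> Y)" using TM H unfolding TM_ideal_def I_def by blast
        then show ?thesis
          using connectedin_continuous_map_image[OF continuous_map_torus_eval[OF e]] by fastforce
      qed
      ultimately have conn: "connected {z. z ^ m H = W H u}" by simp
      have card: "card {z. z ^ m H = W H u} = m H"
        by (rule card_nth_roots[OF mW(3)[OF H u] mW(1)[OF H]])
      then have "finite {z. z ^ m H = W H u}" using mW(1)[OF H] card_ge_0_finite by metis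
      then obtain y where "{z. z ^ m H = W H u} = {} \<or> {z. z ^ m H = W H u} = {y}"
        using conn connected_finite_iff_sing by blast
      then show "m H = 1" using card mW(1)[OF H] by auto
    qed
    obtain s where "continuous_map B (Conf n euclidean) s"
      and "\<And>b. b \<in> topspace B \<Longrightarrow> s b ` {..<n} = root_set I m w b"
      using root_set_global_ordering[OF sep one n_def] by blast
    then show ?thesis
      using pullback_Conf[OF _ _ homeo] unfolding S_def by blast
  qed
  ultimately show ?thesis
    unfolding E_def B_def by (intro exI[of _ n]) (auto simp: n_def)
qed

end

theorem theorem3p1p1:
  fixes G :: "('a, 'b) monoid_scheme" and d :: nat
    and \<A> :: "('a \<Rightarrow> complex) set set" and Y :: "('a \<Rightarrow> complex) set"
  assumes "free_abelian_of_rank G d"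
    and "toric_arrangement G \<A>"
    and "corank_one G Y \<A>"
    and "M_ideal G Y \<A>"
  shows
    "(\<exists>ns f. is_composition ns \<and>
        is_pullback_along
          (complement_top (torus_top G) \<A>)
          (complement_top (torus_quotient_top G Y) (quotient_arrangement G Y \<A>))
          (torus_proj G Y)
          (Conf_comp (ns @ [1]) (euclidean :: complex topology))
          (Conf_comp ns (euclidean :: complex topology))
          butlast f) \<and>
     (\<exists>n>0.
        (\<exists>a. is_pullback_along
          (complement_top (torus_top G) \<A>)
          (complement_top (torus_quotient_top G Y) (quotient_arrangement G Y \<A>))
          (torus_proj G Y)
          (Conf_comp [n, 1] (euclidean :: complex topology))
          (Conf_comp [n] (euclidean :: complex topology))
          butlast a) \<and>
        (TM_ideal G Y \<A> \<longrightarrow>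
          (\<exists>b. is_pullback_along
            (complement_top (torus_top G) \<A>)
            (complement_top (torus_quotient_top G Y) (quotient_arrangement G Y \<A>))
            (torus_proj G Y)
            (Conf (n + 1) (euclidean :: complex topology))
            (Conf n (euclidean :: complex topology))
            (\<lambda>x. restrict x {..<n}) b)))"
proof -
  obtain \<XX> where \<A>: "presents G \<XX> \<A>"
    using assms(2) by (auto simp: toric_arrangement_def)
  have "comm_group G"
    using assms(1) by (simp add: free_abelian_of_rank_def)
  then interpret comm_group G .
  obtain \<Phi> where \<Phi>: "\<Phi> \<in> iso G (free_Abelian_group {..<d})"
    using assms(1) by (auto simp: free_abelian_of_rank_def is_iso_def)
  obtain K N where KN: "subgroup K G" "subgroup N G" "K \<inter> N = {\<one>\<^bsub>G\<^esub>}" "K <#>\<^bsub>G\<^esub> N = carrier G"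
    "free_abelian_of_rank (G\<lparr>carrier := K\<rparr>) 1" and Y: "Y = {t \<in> carrier (torus G). \<forall>\<gamma>\<in>N. t \<gamma> = 1}"
    using assms(3) unfolding corank_one_def admissible_def by blast
  obtain e a p where split: "e \<in> carrier G" "a \<in> hom G integer_group" "a e = (1::int)" "p \<in> hom G (G\<lparr>carrier := N\<rparr>)"
    "\<And>x. x \<in> carrier G \<Longrightarrow> e [^]\<^bsub>G\<^esub> a x \<otimes>\<^bsub>G\<^esub> p x = x" "\<And>x. x \<in> N \<Longrightarrow> a x = 0"
    using split_cyclic_summand[OF KN] by blast
  interpret torus_splitting G d \<Phi> N e a p Y
    by (intro torus_splitting.intro free_abelian_coordinates.intro free_abelian_coordinates_axioms.intro
          torus_splitting_axioms.intro) (fact \<open>comm_group G\<close> \<Phi> KN(2) split Y)+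
  obtain n where n: "0 < n"
    "\<exists>f. is_pullback_along (complement_top TT \<A>)
       (complement_top Q (quotient_arrangement G Y \<A>)) proj
       (Conf_comp [n, 1] (euclidean :: complex topology)) (Conf_comp [n] euclidean) butlast f"
    "TM_ideal G Y \<A> \<longrightarrow> (\<exists>f. is_pullback_along (complement_top TT \<A>)
       (complement_top Q (quotient_arrangement G Y \<A>)) proj
       (Conf (n + 1) (euclidean :: complex topology)) (Conf n euclidean) (\<lambda>x. restrict x {..<n}) f)"
    using fibre_bundle_pullbacks[OF \<A> assms(4)] by blast
  have "is_composition [n]" "[n] @ [1] = [n, 1]"
    using n(1) by (simp_all add: is_composition_def)
  then show ?thesis using n by metis
qed

end
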